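(* Let $n,m\ge 1$ be integers, let $\alpha=(a_1,\ldots,a_n),\ \beta=(b_1,\ldots,b_n)\in\mathbb{R}^n$ and $\alpha'=(c_1,\ldots,c_m),\ \beta'=(d_1,\ldots,d_m)\in\mathbb{R}^m$, and set, for $t\in(0,\infty)$, \[ f_{\alpha,\beta}(t)=t^{\gamma(\alpha,\beta)}\prod_{i=1}^n\frac{b_i(t^{a_i}-1)}{a_i(t^{b_i}-1)},\qquad f_{\alpha',\beta'}(t)=t^{\gamma(\alpha',\beta')}\prod_{i=1}^m\frac{d_i(t^{c_i}-1)}{c_i(t^{d_i}-1)}, \] where $\gamma(\alpha,\beta)=\bigl(1-\sum_{i=1}^n(a_i-b_i)\bigr)/2$ and $\gamma(\alpha',\beta')=\bigl(1-\sum_{i=1}^m(c_i-d_i)\bigr)/2$. If the $(n+m)$-tuple $(|b_1|,\ldots,|b_n|,|c_1|,\ldots,|c_m|)$ weakly submajorises $(|a_1|,\ldots,|a_n|,|d_1|,\ldots,|d_m|)$, then $f_{\alpha,\beta}\preceq f_{\alpha',\beta'}$, that is, \[ |||M_{\alpha,\beta}(L_H,R_K)X|||\le |||M_{\alpha',\beta'}(L_H,R_K)X||| \] for every positive integer $N$, all positive invertible matrices $H,K\in\mathbb{M}_N(\mathbb{C})$, every $X\in\mathbb{M}_N(\mathbb{C})$, and every unitarily invariant norm $|||\cdot|||$ on $\mathbb{M}_N(\mathbb{C})$.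
   Context: Conventions: $(t^a-1)/a$ is read as $\log t$ when $a=0$ (both in numerators and, reciprocally, in denominators), and the functions $f_{\alpha,\beta}$ are extended continuously to $t=1$ with value $1$; they are then continuous functions $(0,\infty)\to(0,\infty)$. Weak submajorisation: for $k$-tuples $u,v$ of nonnegative reals, $v$ weakly submajorises $u$ if, after rearranging both in decreasing order $u_1\ge\cdots\ge u_k$, $v_1\ge\cdots\ge v_k$, one has $\sum_{i=1}^j u_i\le\sum_{i=1}^j v_i$ for all $j=1,\ldots,k$. A function $\varphi:\mathbb{R}\to\mathbb{C}$ is positive definite if for all positive integers $n$, all $x_1,\ldots,x_n\in\mathbb{R}$ and all $\alpha_1,\ldots,\alpha_n\in\mathbb{C}$, $\sum_{i,j=1}^n\alpha_i\overline{\alpha_j}\varphi(x_i-x_j)\ge 0$. Relation $\preceq$: for continuous $f,g:(0,\infty)\to(0,\infty)$ with $f(1)=g(1)=1$, $f\preceq g$ means that $x\mapsto f(e^x)/g(e^x)$ is positive definite on $\mathbb{R}$. Operators: equip $\mathbb{M}_N(\mathbb{C})$ with the inner product $\langle X,Y\rangle=\mathrm{Tr}(Y^*X)$, and let $L_A(X)=AX$, $R_A(X)=XA$. For $H,K$ positive and invertible, $L_H,R_K$ are commuting positive invertible operators on this Hilbert space. $M_{\alpha,\beta}(s,t)=t f_{\alpha,\beta}(s/t)$ for $s,t>0$, and $M_{\alpha,\beta}(L_H,R_K)=R_K f_{\alpha,\beta}(L_HR_K^{-1})$ is defined by functional calculus (likewise for $\alpha',\beta'$). A norm on $\mathbb{M}_N(\mathbb{C})$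 is unitarily invariant if $|||UX|||=|||X|||=|||XU|||$ for all $X$ and all unitary $U$. *)

theory Defs
  imports "HOL-Analysis.Analysis"
begin

section \<open>The functions \<open>f\<^sub>\<alpha>\<^sub>,\<^sub>\<beta>\<close>\<close>

text \<open>
  \<open>pow_diff a t\<close> is \<open>(t\<^sup>a - 1) / a\<close>, read as \<open>log t\<close> when \<open>a = 0\<close>. Hence
  \<open>b (t\<^sup>a - 1) / (a (t\<^sup>b - 1)) = pow_diff a t / pow_diff b t\<close>, with the convention applied
  both in the numerator and in the denominator.
\<close>

definition pow_diff :: "real \<Rightarrow> real \<Rightarrow> real" where
  "pow_diff a t = (if a = 0 then ln t else (t powr a - 1) / a)"

definition gamma_exponent :: "real list \<Rightarrow> real list \<Rightarrow> real" where
  "gamma_exponent \<alpha> \<beta> = (1 - (\<Sum>i<length \<alpha>. \<alpha> ! i - \<beta> ! i)) / 2"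

text \<open>
  Only arguments \<open>t > 0\<close> and lists of equal length are relevant. At \<open>t = 1\<close> the factors are
  \<open>0 / 0\<close>; the value \<open>1\<close> is the continuous extension.
\<close>

definition f_fun :: "real list \<Rightarrow> real list \<Rightarrow> real \<Rightarrow> real" where
  "f_fun \<alpha> \<beta> t =
     (if t = 1 then 1
      else t powr gamma_exponent \<alpha> \<beta>
             * (\<Prod>i<length \<alpha>. pow_diff (\<alpha> ! i) t / pow_diff (\<beta> ! i) t))"


section \<open>Weak submajorisation, positive definite functions, and the relation \<open>\<preceq>\<close>\<close>

text \<open>\<open>weakly_submajorises v u\<close>: the tuple \<open>v\<close> (the larger one) weakly submajorises \<open>u\<close>.\<close>

definition weakly_submajorises :: "real list \<Rightarrow> real list \<Rightarrow> bool" where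
  "weakly_submajorises v u \<longleftrightarrow>
     length u = length v \<and>
     (\<forall>j\<in>{1..length v}. sum_list (take j (rev (sort u))) \<le> sum_list (take j (rev (sort v))))"

text \<open>
  Membership in \<open>\<real>\<^sub>\<ge>\<^sub>0\<close> says that the complex number is real and nonnegative.
\<close>

definition positive_definite_fun :: "(real \<Rightarrow> complex) \<Rightarrow> bool" where
  "positive_definite_fun \<phi> \<longleftrightarrow>
     (\<forall>n\<ge>1. \<forall>(x :: nat \<Rightarrow> real) (c :: nat \<Rightarrow> complex).
        (\<Sum>i<n. \<Sum>j<n. c i * cnj (c j) * \<phi> (x i - x j)) \<in> \<real>\<^sub>\<ge>\<^sub>0)"

text \<open>Functions on \<open>(0,\<infinity>)\<close> are total functions whose values outside \<open>(0,\<infinity>)\<close> are not used.\<close>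

definition fun_preceq :: "(real \<Rightarrow> real) \<Rightarrow> (real \<Rightarrow> real) \<Rightarrow> bool" (infix \<open>\<preceq>\<close> 50) where
  "f \<preceq> g \<longleftrightarrow> positive_definite_fun (\<lambda>x. complex_of_real (f (exp x) / g (exp x)))"


section \<open>Complex matrices\<close>

definition cadjoint :: "complex^'n^'m \<Rightarrow> complex^'m^'n" where
  "cadjoint A = (\<chi> i j. cnj (A $ j $ i))"

definition unitary_matrix :: "complex^'n^'n \<Rightarrow> bool" where
  "unitary_matrix U \<longleftrightarrow> cadjoint U ** U = mat 1 \<and> U ** cadjoint U = mat 1"

definition positive_matrix :: "complex^'n^'n \<Rightarrow> bool" where
  "positive_matrix A \<longleftrightarrow>
     (\<forall>x :: complex^'n. (\<Sum>i\<in>UNIV. (A *v x) $ i * cnj (x $ i)) \<in> \<real>\<^sub>\<ge>\<^sub>0)"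

definition unitarily_invariant_norm :: "(complex^'n^'n \<Rightarrow> real) \<Rightarrow> bool" where
  "unitarily_invariant_norm \<nu> \<longleftrightarrow>
     (\<forall>X. 0 \<le> \<nu> X) \<and>
     (\<forall>X. \<nu> X = 0 \<longleftrightarrow> X = 0) \<and>
     (\<forall>(c :: complex) X. \<nu> (\<chi> i j. c * X $ i $ j) = cmod c * \<nu> X) \<and>
     (\<forall>X Y. \<nu> (X + Y) \<le> \<nu> X + \<nu> Y) \<and>
     (\<forall>U X. unitary_matrix U \<longrightarrow> \<nu> (U ** X) = \<nu> X \<and> \<nu> (X ** U) = \<nu> X)"


section \<open>Functional calculus on the Hilbert space of matrices\<close>

definition hs_inner :: "complex^'n^'n \<Rightarrow> complex^'n^'n \<Rightarrow> complex" where
  "hs_inner X Y = trace (cadjoint Y ** X)"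

text \<open>Eigenvalues and eigenspaces are only used for self-adjoint operators, so real
  eigenvalues suffice.\<close>

definition op_eigenspace :: "(complex^'n^'n \<Rightarrow> complex^'n^'n) \<Rightarrow> real \<Rightarrow> (complex^'n^'n) set" where
  "op_eigenspace T l = {X. T X = l *\<^sub>R X}"

definition op_spectrum :: "(complex^'n^'n \<Rightarrow> complex^'n^'n) \<Rightarrow> real set" where
  "op_spectrum T = {l. \<exists>X. X \<noteq> 0 \<and> X \<in> op_eigenspace T l}"

definition orth_projection :: "(complex^'n^'n) set \<Rightarrow> complex^'n^'n \<Rightarrow> complex^'n^'n" where
  "orth_projection S X = (THE Y. Y \<in> S \<and> (\<forall>Z\<in>S. hs_inner (X - Y) Z = 0))"

text \<open>
  For self-adjoint \<open>T\<close> with spectral decomposition \<open>T = (\<Sum>l. l P\<^sub>l)\<close>, this is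
  \<open>f(T) = (\<Sum>l. f(l) P\<^sub>l)\<close>, the sums being over the (finite) spectrum of \<open>T\<close>.
\<close>

definition fun_calculus ::
    "(real \<Rightarrow> real) \<Rightarrow> (complex^'n^'n \<Rightarrow> complex^'n^'n) \<Rightarrow> complex^'n^'n \<Rightarrow> complex^'n^'n" where
  "fun_calculus f T X = (\<Sum>l\<in>op_spectrum T. f l *\<^sub>R orth_projection (op_eigenspace T l) X)"

definition L_op :: "complex^'n^'n \<Rightarrow> complex^'n^'n \<Rightarrow> complex^'n^'n" where
  "L_op A X = A ** X"

definition R_op :: "complex^'n^'n \<Rightarrow> complex^'n^'n \<Rightarrow> complex^'n^'n" where
  "R_op A X = X ** A"

text \<open>\<open>M\<^sub>\<alpha>\<^sub>,\<^sub>\<beta>(L\<^sub>H, R\<^sub>K) = R\<^sub>K f\<^sub>\<alpha>\<^sub>,\<^sub>\<beta>(L\<^sub>H R\<^sub>K\<^sup>-\<^sup>1)\<close>, where \<open>M\<^sub>\<alpha>\<^sub>,\<^sub>\<beta>(s, t) = t f\<^sub>\<alpha>\<^sub>,\<^sub>\<beta>(s / t)\<close>;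
  the inverse of \<open>R\<^sub>K\<close> is the inverse of a map, as \<open>R\<^sub>K\<close> is bijective for invertible \<open>K\<close>.\<close>

definition M_op ::
    "real list \<Rightarrow> real list \<Rightarrow> complex^'n^'n \<Rightarrow> complex^'n^'n \<Rightarrow> complex^'n^'n \<Rightarrow> complex^'n^'n" where
  "M_op \<alpha> \<beta> H K = R_op K \<circ> fun_calculus (f_fun \<alpha> \<beta>) (L_op H \<circ> inv (R_op K))"

end

theory Submission
  imports Defs
begin

text \<open>
  Put \<open>shc y = sinh y / y\<close>. Then \<open>f\<^sub>\<alpha>\<^sub>,\<^sub>\<beta>(e\<^sup>x) / f\<^sub>\<alpha>\<^sub>'\<^sub>,\<^sub>\<beta>\<^sub>'(e\<^sup>x)\<close> is a product of quotients
  \<open>shc(u\<^sub>i x / 2) / shc(v\<^sub>i x / 2)\<close>, where \<open>u\<close> is weakly submajorised by \<open>v\<close>, and it is enough to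
  show that it lies in the closure of the convex combinations of characters. If all \<open>u\<^sub>i, v\<^sub>i\<close> are
  integer multiples of some \<open>d\<close>, the product factors into powers of
  \<open>shc(jdx)\<^sup>2 / (shc((j+1)dx) shc((j-1)dx))\<close>, the multiplicative second differences of \<open>shc\<close>, with
  exponents \<open>\<Sum>\<^sub>i (v\<^sub>i/d - j)\<^sub>+ - (u\<^sub>i/d - j)\<^sub>+\<close>, which weak submajorisation makes nonnegative; the
  general case follows by approximation. Each such factor is a geometric series in \<open>(shc(dx) / shc(jdx))\<^sup>2\<close>, and \<open>shc(hx) / shc(vx)\<close> for \<open>h \<le> v\<close> is
  handled by the product formula for the sine. In eigenbases of \<open>H\<close> and \<open>K\<close> a character acts as
  \<open>Y \<mapsto> H\<^sup>i\<^sup>s Y K\<^sup>-\<^sup>i\<^sup>s\<close>, which preserves every unitarily invariant norm.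
\<close>

section \<open>The closed convex hull of the characters\<close>

text \<open>Inductive, so that positive definiteness and norm contraction can each be checked on the
  four rules. Allowing \<open>p + q \<le> 1\<close> admits the zero function, where partial sums of
  series start.\<close>

inductive_set char_hull :: "(real \<Rightarrow> complex) set" where
  char: "(\<lambda>x. cis (s * x)) \<in> char_hull"
| mult: "f \<in> char_hull \<Longrightarrow> g \<in> char_hull \<Longrightarrow> (\<lambda>x. f x * g x) \<in> char_hull"
| comb: "f \<in> char_hull \<Longrightarrow> g \<in> char_hull \<Longrightarrow> 0 \<le> p \<Longrightarrow> 0 \<le> q \<Longrightarrow> p + q \<le> 1 \<Longrightarrow>
    (\<lambda>x. of_real p * f x + of_real q * g x) \<in> char_hull"
| lim: "(\<And>n::nat. F n \<in> char_hull) \<Longrightarrow> (\<And>x. (\<lambda>n. F n x) \<longlonglongrightarrow> f x) \<Longrightarrow> f \<in> char_hull"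

lemma char_hull_one: "(\<lambda>x. 1) \<in> char_hull"
  using char_hull.char[of 0] by simp

lemma char_hull_zero: "(\<lambda>x. 0) \<in> char_hull"
  using char_hull.comb[OF char_hull_one char_hull_one, of 0 0] by simp

lemma char_hull_power: "f \<in> char_hull \<Longrightarrow> (\<lambda>x. f x ^ n) \<in> char_hull"
  by (induction n) (auto intro: char_hull_one char_hull.mult)

lemma char_hull_prod:
  "finite I \<Longrightarrow> (\<And>i. i \<in> I \<Longrightarrow> f i \<in> char_hull) \<Longrightarrow> (\<lambda>x. \<Prod>i\<in>I. f i x) \<in> char_hull"
  by (induction I rule: finite_induct) (auto intro: char_hull_one char_hull.mult)

lemma norm_char_hull_le_1: "f \<in> char_hull \<Longrightarrow> norm (f x) \<le> 1"
proof (induction rule: char_hull.induct)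
  case (mult f g)
  then show ?case by (simp add: norm_mult mult_le_one)
next
  case (comb f g p q)
  have "norm (of_real p * f x + of_real q * g x) \<le> p * norm (f x) + q * norm (g x)"
    using comb by (intro order_trans[OF norm_triangle_ineq]) (simp add: norm_mult)
  also have "\<dots> \<le> p * 1 + q * 1"
    using comb by (intro add_mono mult_left_mono) auto
  finally show ?case using comb by simp
next
  case (lim F f)
  then show ?case by (intro LIMSEQ_le_const2[OF tendsto_norm[OF lim(2)]]) auto
qed auto

text \<open>Expanding the quotient gives powers \<open>f x ^ k\<close> with weights
  \<open>(1 - a) * a ^ k\<close>, which are nonnegative and sum to 1.\<close>

lemma char_hull_geometric:
  assumes f: "f \<in> char_hull" and a: "0 \<le> a" "a < 1"
  shows "(\<lambda>x. of_real (1 - a) / (1 - of_real a * f x)) \<in> char_hull"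
proof (rule char_hull.lim)
  let ?F = "\<lambda>n x. of_real (1 - a) * (\<Sum>k<n. (of_real a * f x) ^ k)"
  show "?F n \<in> char_hull" for n
  proof (induction n)
    case (Suc n)
    \<comment> \<open>Horner form: a convex combination of 1 and \<open>f\<close> times the previous
      partial sum.\<close>
    have eq: "?F (Suc n) = (\<lambda>x. of_real (1 - a) * 1 + of_real a * (f x * ?F n x))"
      by (simp add: sum.lessThan_Suc_shift sum_distrib_left algebra_simps del: sum.lessThan_Suc)
    show ?case
      unfolding eq using a by (intro char_hull.comb char_hull.mult f Suc char_hull_one) auto
  qed (simp add: char_hull_zero)
  fix x
  have "norm (of_real a * f x) \<le> a * 1"
    using a norm_char_hull_le_1[OF f, of x] by (simp add: norm_mult mult_left_le)
  then have "(\<lambda>k. (of_real a * f x) ^ k) sums (1 / (1 - of_real a * f x))"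
    using a by (intro geometric_sums) auto
  from tendsto_mult_left[OF this[unfolded sums_def], of "of_real (1 - a)"]
  show "(\<lambda>n. ?F n x) \<longlonglongrightarrow> of_real (1 - a) / (1 - of_real a * f x)"
    by simp
qed

text \<open>A geometric distribution of ratio \<open>1 - h\<close> on the multiples of \<open>h\<close> tends to the exponential one as \<open>h \<rightarrow> 0\<close>.\<close>

lemma char_hull_exponential: "(\<lambda>x. 1 / (1 - \<i> * of_real (c * x))) \<in> char_hull"
proof (rule char_hull.lim)
  let ?h = "\<lambda>n. 1 / real (Suc (Suc n))"
  let ?F = "\<lambda>n x. of_real (1 - (1 - ?h n)) / (1 - of_real (1 - ?h n) * cis (c * ?h n * x))"
  show "?F n \<in> char_hull" for n
    by (intro char_hull_geometric char_hull.char) auto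
  fix x
  have h: "?h \<longlonglongrightarrow> 0"
    by real_asymp
  \<comment> \<open>The reciprocal of \<open>?F n x\<close> is minus a difference quotient at 0 of
    this function, whose value there is 1.\<close>
  have deriv: "((\<lambda>z. (1 - z) * exp (\<i> * of_real (c * x) * z)) has_field_derivative (\<i> * of_real (c * x) - 1)) (at 0)"
    by (auto intro!: derivative_eq_intros)
  have "(\<lambda>n. (of_real (?h n) :: complex)) \<longlonglongrightarrow> of_real 0"
    using h by (rule tendsto_of_real)
  then have "filterlim (\<lambda>n. of_real (?h n) :: complex) (at 0) sequentially"
    by (simp add: filterlim_at del: of_real_divide of_nat_Suc)
  from filterlim_compose[OF deriv[unfolded has_field_derivative_iff] this]
  have "(\<lambda>n. ((1 - of_real (?h n)) * exp (\<i> * of_real (c * x) * of_real (?h n)) - 1) / of_real (?h n))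
     \<longlonglongrightarrow> \<i> * of_real (c * x) - 1"
    by simp
  from tendsto_divide[OF tendsto_const tendsto_minus[OF this], of 1]
  have "(\<lambda>n. 1 / - (((1 - of_real (?h n)) * exp (\<i> * of_real (c * x) * of_real (?h n)) - 1) / of_real (?h n)))
     \<longlonglongrightarrow> 1 / - (\<i> * of_real (c * x) - 1)"
    by (auto simp: complex_eq_iff)
  moreover have "of_real (1 - (1 - h)) / (1 - of_real (1 - h) * cis (c * h * x)) =
      1 / - (((1 - of_real h) * exp (\<i> * of_real (c * x) * of_real h) - 1) / of_real h)" for h :: real
    by (simp add: cis_conv_exp mult_ac minus_divide_left)
  ultimately show "(\<lambda>n. ?F n x) \<longlonglongrightarrow> 1 / (1 - \<i> * of_real (c * x))"
    by (simp only: minus_diff_eq)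
qed

text \<open>Characteristic function of a Laplace distribution: the product of two exponential ones
  with opposite scales.\<close>

lemma char_hull_laplace: "(\<lambda>x. of_real (1 / (1 + (c * x)\<^sup>2))) \<in> char_hull"
proof -
  have eq: "of_real (1 / (1 + (c * x)\<^sup>2)) = 1 / (1 - \<i> * of_real (c * x)) * (1 / (1 - \<i> * of_real (- c * x)))" for x
  proof -
    have "(1 - \<i> * of_real (c * x)) * (1 - \<i> * of_real (- c * x)) = of_real (1 + (c * x)\<^sup>2)"
      by (simp add: algebra_simps power2_eq_square)
    then show ?thesis by (simp flip: of_real_mult)
  qed
  show ?thesis
    unfolding eq by (intro char_hull.mult char_hull_exponential)
qed

section \<open>Quotients of \<open>sinh y / y\<close>\<close>

definition shc :: "real \<Rightarrow> real" where
  "shc y = (if y = 0 then 1 else sinh y / y)"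

lemma shc_0 [simp]: "shc 0 = 1" by (simp add: shc_def)

lemma sinh_eq_shc: "sinh y = y * shc y" by (simp add: shc_def)

lemma shc_minus [simp]: "shc (- y) = shc y" by (simp add: shc_def)

lemma shc_pos: "0 < shc y"
  by (cases y "0 :: real" rule: linorder_cases) (auto simp: shc_def zero_less_divide_iff)

lemma shc_nonzero [simp]: "shc y \<noteq> 0" using shc_pos[of y] by simp

lemma isCont_shc: "isCont shc y"
proof (cases "y = 0")
  case True
  have "((\<lambda>y::real. sinh y / y) \<longlongrightarrow> 1) (at 0)"
    using has_field_derivative_sinh[OF DERIV_ident, of "0::real" UNIV] by (simp add: has_field_derivative_iff)
  then show ?thesis
    unfolding True isCont_def shc_0 by (rule Lim_transform_eventually) (auto simp: shc_def eventually_at_filter)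
next
  case False
  have "isCont (\<lambda>y. sinh y / y) y"
    using False by (intro continuous_intros) auto
  moreover have "\<forall>\<^sub>F z in nhds y. shc z = sinh z / z"
  proof -
    have "\<forall>\<^sub>F z in nhds y. z \<in> - {0}" using False by (intro eventually_nhds_in_open) auto
    then show ?thesis by eventually_elim (simp add: shc_def)
  qed
  ultimately show ?thesis
    using isCont_cong[of shc "\<lambda>y. sinh y / y" y] by blast
qed

lemmas tendsto_shc [tendsto_intros] = isCont_tendsto_compose[OF isCont_shc]

text \<open>Euler's product for \<open>sin (pi * z)\<close> at \<open>z = \<i> * y / pi\<close>,
  where the sine equals \<open>\<i> * sinh y\<close>.\<close>

lemma shc_product: "(\<lambda>n. \<Prod>k=1..n. 1 + y\<^sup>2 / (pi * real k)\<^sup>2) \<longlonglongrightarrow> shc y"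
proof (cases "y = 0")
  case False
  let ?z = "\<i> * of_real (y / pi) :: complex"
  have "(\<lambda>n. of_real pi * ?z * (\<Prod>k=1..n. 1 - ?z^2 / of_nat k^2)) \<longlonglongrightarrow> sin (of_real pi * ?z)"
    by (rule sin_product_formula_complex)
  also have "sin (of_real pi * ?z) = \<i> * of_real (sinh y)"
    by (simp add: sin_i_times sinh_field_def exp_of_real exp_minus)
  also have "of_real (sinh y) = of_real y * complex_of_real (shc y)"
    by (simp add: sinh_eq_shc)
  finally have "(\<lambda>n. of_real pi * ?z * (\<Prod>k=1..n. 1 - ?z^2 / of_nat k^2) / (\<i> * of_real y))
      \<longlonglongrightarrow> \<i> * of_real y * of_real (shc y) / (\<i> * of_real y)"
    using False by (intro tendsto_divide tendsto_const) (auto simp: mult.assoc)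
  also have "(\<lambda>n. of_real pi * ?z * (\<Prod>k=1..n. 1 - ?z^2 / of_nat k^2) / (\<i> * of_real y)) =
      (\<lambda>n. of_real (\<Prod>k=1..n. 1 + y\<^sup>2 / (pi * real k)\<^sup>2))"
    using False by (simp add: power_mult_distrib power_divide field_simps)
  also have "\<i> * of_real y * of_real (shc y) / (\<i> * of_real y) = complex_of_real (shc y)"
    using False by simp
  finally show ?thesis by (simp only: tendsto_of_real_iff)
qed simp

text \<open>Dividing the two products factor by factor leaves terms
  \<open>(1 + a * w) / (1 + w) = a + (1 - a) / (1 + w)\<close> with
  \<open>a = (h / v)\<^sup>2\<close>. As \<open>a \<le> 1\<close>, these are convex combinations of
  1 and a Laplace characteristic function.\<close>

lemma char_hull_shc_ratio:
  assumes "0 \<le> h" "h \<le> v"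
  shows "(\<lambda>x. of_real (shc (h * x) / shc (v * x))) \<in> char_hull"
proof (cases "v = 0")
  case False
  with assms have v: "v > 0" by simp
  define a where "a = (h / v)\<^sup>2"
  have a: "0 \<le> a" "a \<le> 1" and hv: "h\<^sup>2 = a * v\<^sup>2"
    using assms v by (auto simp: a_def power_divide power_mono)
  let ?F = "\<lambda>n x. \<Prod>k=1..n. complex_of_real a * 1 + of_real (1 - a) * of_real (1 / (1 + (v / (pi * real k) * x)\<^sup>2))"
  show ?thesis
  proof (rule char_hull.lim)
    show "?F n \<in> char_hull" for n
      using a by (intro char_hull_prod char_hull.comb char_hull_one char_hull_laplace) auto
    fix x
    have fac: "a * 1 + (1 - a) * (1 / (1 + (v / (pi * real k) * x)\<^sup>2)) =
        (1 + (h * x)\<^sup>2 / (pi * real k)\<^sup>2) / (1 + (v * x)\<^sup>2 / (pi * real k)\<^sup>2)" for k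
    proof -
      have p: "1 + (v * x)\<^sup>2 / (pi * real k)\<^sup>2 > 0" by (simp add: add_pos_nonneg)
      have "(h * x)\<^sup>2 = a * (v * x)\<^sup>2" using hv by (simp add: power_mult_distrib)
      moreover have "(v / (pi * real k) * x)\<^sup>2 = (v * x)\<^sup>2 / (pi * real k)\<^sup>2"
        by (simp add: power_mult_distrib power_divide)
      moreover have "a * 1 + (1 - a) * (1 / (1 + w)) = (1 + a * w) / (1 + w)" if "1 + w > 0" for w
        using that by (simp add: field_simps)
      ultimately show ?thesis using p by (metis times_divide_eq_right)
    qed
    have "(\<lambda>n. (\<Prod>k=1..n. 1 + (h * x)\<^sup>2 / (pi * real k)\<^sup>2) / (\<Prod>k=1..n. 1 + (v * x)\<^sup>2 / (pi * real k)\<^sup>2))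
        \<longlonglongrightarrow> shc (h * x) / shc (v * x)"
      by (intro tendsto_divide shc_product) simp
    then have "(\<lambda>n. \<Prod>k=1..n. a * 1 + (1 - a) * (1 / (1 + (v / (pi * real k) * x)\<^sup>2))) \<longlonglongrightarrow> shc (h * x) / shc (v * x)"
      unfolding fac prod_dividef .
    from tendsto_of_real[OF this, where 'a = complex]
    show "(\<lambda>n. ?F n x) \<longlonglongrightarrow> of_real (shc (h * x) / shc (v * x))" by simp
  qed
qed (use assms in \<open>simp add: char_hull_one\<close>)

text \<open>The identity \<open>sinh (y + z) * sinh (y - z) = (sinh y)\<^sup>2 - (sinh
  z)\<^sup>2\<close> turns the quotient into the closed form of a geometric series in the square of
  \<open>shc (d * x) / shc (v * x)\<close>, with ratio parameter
  \<open>a = (d / v)\<^sup>2\<close>.\<close>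

lemma char_hull_shc_second_difference:
  assumes "0 \<le> d" "d \<le> v"
  shows "(\<lambda>x. of_real ((shc (v * x))\<^sup>2 / (shc ((v + d) * x) * shc ((v - d) * x)))) \<in> char_hull"
proof -
  \<comment> \<open>Strictness keeps \<open>a < 1\<close>; at \<open>d = v\<close> the closed form
    would be 0/0, so that case is reached as a limit.\<close>
  have strict: "(\<lambda>x. of_real ((shc (v * x))\<^sup>2 / (shc ((v + d) * x) * shc ((v - d) * x)))) \<in> char_hull"
    if d: "0 \<le> d" "d < v" for d
  proof -
    define a where "a = (d / v)\<^sup>2"
    have a: "0 \<le> a" "a < 1" and dv: "d\<^sup>2 = a * v\<^sup>2"
      using d by (auto simp: a_def power_divide power_strict_mono)
    have eq: "(shc (v * x))\<^sup>2 / (shc ((v + d) * x) * shc ((v - d) * x)) =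
       (1 - a) / (1 - a * (shc (d * x) / shc (v * x))\<^sup>2)" for x
    proof (cases "x = 0")
      case False
      have "sinh ((v + d) * x) * sinh ((v - d) * x) = (sinh (v * x))\<^sup>2 - (sinh (d * x))\<^sup>2"
      proof -
        have c: "(cosh y)\<^sup>2 = (sinh y)\<^sup>2 + 1" for y :: real by (rule cosh_square_eq)
        have "sinh ((v + d) * x) * sinh ((v - d) * x) =
          (sinh (v * x))\<^sup>2 * (cosh (d * x))\<^sup>2 - (cosh (v * x))\<^sup>2 * (sinh (d * x))\<^sup>2"
          by (simp add: ring_distribs sinh_add sinh_diff power2_eq_square)
        then show ?thesis unfolding c by (simp add: algebra_simps)
      qed
      then have "x\<^sup>2 * ((v\<^sup>2 - d\<^sup>2) * (shc ((v + d) * x) * shc ((v - d) * x))) = x\<^sup>2 * (v\<^sup>2 * (shc (v * x))\<^sup>2 - d\<^sup>2 * (shc (d * x))\<^sup>2)"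
        unfolding sinh_eq_shc by (simp add: algebra_simps power2_eq_square)
      then have "(v\<^sup>2 - d\<^sup>2) * (shc ((v + d) * x) * shc ((v - d) * x)) = v\<^sup>2 * (shc (v * x))\<^sup>2 - d\<^sup>2 * (shc (d * x))\<^sup>2"
        using False by (subst (asm) mult_cancel_left) simp
      then have "v\<^sup>2 * ((1 - a) * (shc ((v + d) * x) * shc ((v - d) * x))) = v\<^sup>2 * ((shc (v * x))\<^sup>2 - a * (shc (d * x))\<^sup>2)"
        unfolding dv by (simp add: algebra_simps)
      then have e: "(1 - a) * (shc ((v + d) * x) * shc ((v - d) * x)) = (shc (v * x))\<^sup>2 - a * (shc (d * x))\<^sup>2"
        using d by simp
      have "1 - a * (shc (d * x) / shc (v * x))\<^sup>2 = ((1 - a) * (shc ((v + d) * x) * shc ((v - d) * x))) / (shc (v * x))\<^sup>2"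
        unfolding e by (simp add: diff_divide_distrib power_divide)
      then show ?thesis using a by simp
    qed (use a in simp)
    have "(\<lambda>x. of_real (1 - a) / (1 - of_real a * (of_real (shc (d * x) / shc (v * x)))^2)) \<in> char_hull"
      using a d by (intro char_hull_geometric char_hull_power char_hull_shc_ratio) auto
    then show ?thesis unfolding eq by simp
  qed
  show ?thesis
  proof (cases "v = 0")
    case False
    with assms have v: "v > 0" by simp
    let ?d = "\<lambda>n. d * (1 - 1 / real (Suc (Suc n)))"
    have "(\<lambda>n. d * (1 - 1 / real (Suc (Suc n)))) \<longlonglongrightarrow> d * (1 - 0)"
      by (intro tendsto_intros) real_asymp
    then have l: "?d \<longlonglongrightarrow> d" by simp
    show ?thesis
    proof (rule char_hull.lim)
      fix n
      have "?d n < v"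
      proof (cases "d = 0")
        case False
        then have "?d n < d * 1" using assms by (intro mult_strict_left_mono) auto
        then show ?thesis using assms by simp
      qed (use v in simp)
      then show "(\<lambda>x. of_real ((shc (v * x))\<^sup>2 / (shc ((v + ?d n) * x) * shc ((v - ?d n) * x)))) \<in> char_hull"
        using assms by (intro strict) auto
    next
      fix x
      show "(\<lambda>n. of_real ((shc (v * x))\<^sup>2 / (shc ((v + ?d n) * x) * shc ((v - ?d n) * x)))) \<longlonglongrightarrow>
          complex_of_real ((shc (v * x))\<^sup>2 / (shc ((v + d) * x) * shc ((v - d) * x)))"
        by (intro tendsto_of_real tendsto_divide tendsto_mult tendsto_shc tendsto_add tendsto_diff tendsto_const l) simp
    qed
  qed (use assms in \<open>simp add: char_hull_one\<close>)
qed

text \<open>Two summations recover \<open>1 / shc (real k * d * x)\<close> from its multiplicative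
  second differences: it is the product of the \<open>E j x\<close> with exponents
  \<open>k - j\<close>. Truncated subtraction supplies the positive part.\<close>

lemma char_hull_shc_lattice:
  fixes p q :: "'i \<Rightarrow> nat"
  assumes I: "finite I" and d: "0 \<le> d"
    and le: "\<And>j. (\<Sum>i\<in>I. p i - j) \<le> (\<Sum>i\<in>I. q i - j)"
  shows "(\<lambda>x. of_real (\<Prod>i\<in>I. shc (real (p i) * d * x) / shc (real (q i) * d * x))) \<in> char_hull"
proof -
  define E where "E = (\<lambda>j x. (shc (real j * d * x))\<^sup>2 / (shc (real (Suc j) * d * x) * shc (real (j - 1) * d * x)))"
  \<comment> \<open>At \<open>j = 0\<close> the truncated \<open>j - 1\<close> makes \<open>E j x\<close> equal to \<open>1 / shc (d * x)\<close>, the correct boundary factor.\<close>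
  have E_hull: "(\<lambda>x. of_real (E j x)) \<in> char_hull" for j
  proof (cases j)
    case 0
    then show ?thesis
      using char_hull_shc_ratio[of 0 d] d by (simp add: E_def)
  next
    case (Suc k)
    have "d \<le> real j * d" using Suc d mult_right_mono[of 1 "real j" d] by simp
    from char_hull_shc_second_difference[OF d this] show ?thesis
      by (simp add: E_def Suc algebra_simps)
  qed
  have E_pos: "E j x \<noteq> 0" for j x by (simp add: E_def)
  \<comment> \<open>First summation, by telescoping. For \<open>k = 0\<close> truncation gives
    \<open>shc 0 / shc 0\<close>, matching the empty product.\<close>
  have prod_E: "(\<Prod>j<k. E j x) = shc (real (k - 1) * d * x) / shc (real k * d * x)" for k x
    by (induction k) (simp_all add: E_def power2_eq_square)
  have prod_E_power: "(\<Prod>j<M. E j x ^ (k - j)) = 1 / shc (real k * d * x)" if "k \<le> M" for k M x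
    using that
  proof (induction k)
    case (Suc k)
    \<comment> \<open>Second summation: \<open>Suc k - j\<close> exceeds \<open>k - j\<close> by one
      exactly when \<open>j < Suc k\<close>.\<close>
    have "(\<Prod>j<M. E j x ^ (Suc k - j)) = (\<Prod>j<M. E j x ^ (k - j) * (if j < Suc k then E j x else 1))"
      by (intro prod.cong) (auto simp: Suc_diff_le not_less_eq)
    also have "\<dots> = 1 / shc (real k * d * x) * (\<Prod>j\<in>{..<M} \<inter> {..<Suc k}. E j x)"
      unfolding prod.distrib using Suc by (subst prod.inter_restrict) auto
    also have "{..<M} \<inter> {..<Suc k} = {..<Suc k}" using Suc by auto
    also have "1 / shc (real k * d * x) * (\<Prod>j<Suc k. E j x) = 1 / shc (real (Suc k) * d * x)"
      unfolding prod_E by simp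
    finally show ?case .
  qed simp
  \<comment> \<open>A crude common bound: exponents \<open>k - j\<close> vanish for
    \<open>j \<ge> k\<close>, so all products can run over \<open>j < M\<close>.\<close>
  define M where "M = (\<Sum>i\<in>I. p i + q i)"
  have M: "p i \<le> M" "q i \<le> M" if "i \<in> I" for i
    using member_le_sum[of i I "\<lambda>i. p i + q i"] I that by (auto simp: M_def)
  have prod_I: "(\<Prod>i\<in>I. 1 / shc (real (r i) * d * x)) = (\<Prod>j<M. E j x ^ (\<Sum>i\<in>I. r i - j))"
    if "\<And>i. i \<in> I \<Longrightarrow> r i \<le> M" for r :: "'i \<Rightarrow> nat" and x
  proof -
    have "(\<Prod>i\<in>I. 1 / shc (real (r i) * d * x)) = (\<Prod>i\<in>I. \<Prod>j<M. E j x ^ (r i - j))"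
      using that by (intro prod.cong) (auto simp: prod_E_power)
    also have "\<dots> = (\<Prod>j<M. \<Prod>i\<in>I. E j x ^ (r i - j))" by (rule prod.swap)
    finally show ?thesis by (simp add: power_sum)
  qed
  have "(\<Prod>i\<in>I. shc (real (p i) * d * x) / shc (real (q i) * d * x)) =
      (\<Prod>j<M. E j x ^ ((\<Sum>i\<in>I. q i - j) - (\<Sum>i\<in>I. p i - j)))" for x
  proof -
    have "(\<Prod>i\<in>I. shc (real (p i) * d * x) / shc (real (q i) * d * x)) =
       (\<Prod>i\<in>I. 1 / shc (real (q i) * d * x)) / (\<Prod>i\<in>I. 1 / shc (real (p i) * d * x))"
      by (simp flip: prod_dividef)
    \<comment> \<open>By \<open>le\<close> this subtraction of exponents is not truncated.\<close>
    also have "\<dots> = (\<Prod>j<M. E j x ^ ((\<Sum>i\<in>I. q i - j) - (\<Sum>i\<in>I. p i - j)))"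
      using M le by (simp add: prod_I power_diff E_pos flip: prod_dividef)
    finally show ?thesis .
  qed
  then show ?thesis
    by (simp add: char_hull_prod char_hull_power E_hull)
qed

text \<open>Rounding \<open>u\<close> down and \<open>v\<close> up to multiples of
  \<open>1 / Suc n\<close> keeps the inequality between positive parts, so the lattice case applies;
  continuity of \<open>shc\<close> gives the limit.\<close>

lemma char_hull_shc_prod:
  fixes u v :: "'i \<Rightarrow> real"
  assumes I: "finite I" and u: "\<And>i. i \<in> I \<Longrightarrow> 0 \<le> u i" and v: "\<And>i. i \<in> I \<Longrightarrow> 0 \<le> v i"
    and le: "\<And>s. 0 \<le> s \<Longrightarrow> (\<Sum>i\<in>I. max (u i - s) 0) \<le> (\<Sum>i\<in>I. max (v i - s) 0)"
  shows "(\<lambda>x. of_real (\<Prod>i\<in>I. shc (u i * x) / shc (v i * x))) \<in> char_hull"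
proof (rule char_hull.lim)
  define d where "d = (\<lambda>n. 1 / real (Suc n))"
  let ?p = "\<lambda>n i. nat \<lfloor>real (Suc n) * u i\<rfloor>" and ?q = "\<lambda>n i. nat \<lceil>real (Suc n) * v i\<rceil>"
  let ?F = "\<lambda>n x. complex_of_real (\<Prod>i\<in>I. shc (real (?p n i) * d n * x) / shc (real (?q n i) * d n * x))"
  show "?F n \<in> char_hull" for n
  proof (rule char_hull_shc_lattice[OF I])
    fix j
    let ?N = "real (Suc n)"
    \<comment> \<open>The hypothesis is used at \<open>s = j / Suc n\<close>, between the two
      roundings.\<close>
    have "real (\<Sum>i\<in>I. ?p n i - j) \<le> (\<Sum>i\<in>I. ?N * max (u i - j / ?N) 0)"
      unfolding of_nat_sum
    proof (rule sum_mono)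
      fix i assume "i \<in> I"
      have "real (?p n i) \<le> ?N * u i" using u[OF \<open>i \<in> I\<close>] by simp
      then have "real (?p n i - j) \<le> max (?N * u i - j) 0" by linarith
      also have "\<dots> = ?N * max (u i - j / ?N) 0"
        by (simp add: max_mult_distrib_left right_diff_distrib)
      finally show "real (?p n i - j) \<le> ?N * max (u i - j / ?N) 0" .
    qed
    also have "\<dots> \<le> (\<Sum>i\<in>I. ?N * max (v i - j / ?N) 0)"
      unfolding sum_distrib_left[symmetric] by (intro mult_left_mono le) auto
    also have "\<dots> \<le> real (\<Sum>i\<in>I. ?q n i - j)"
      unfolding of_nat_sum
    proof (rule sum_mono)
      fix i assume "i \<in> I"
      have "?N * max (v i - j / ?N) 0 = max (?N * v i - j) 0"
        by (simp add: max_mult_distrib_left right_diff_distrib)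
      also have "\<dots> \<le> real (?q n i - j)"
        using of_nat_ceiling[of "?N * v i"] by linarith
      finally show "?N * max (v i - j / ?N) 0 \<le> real (?q n i - j)" .
    qed
    finally show "(\<Sum>i\<in>I. ?p n i - j) \<le> (\<Sum>i\<in>I. ?q n i - j)" by linarith
  qed (simp add: d_def)
  have d0: "d \<longlonglongrightarrow> 0" unfolding d_def by real_asymp
  have p_lim: "(\<lambda>n. real (?p n i) * d n) \<longlonglongrightarrow> u i" if "i \<in> I" for i
  proof (rule tendsto_sandwich)
    have "(real (Suc n) * u i - 1) * d n \<le> real (?p n i) * d n"
        "real (?p n i) * d n \<le> (real (Suc n) * u i) * d n" for n
      using u[OF that] by (intro mult_right_mono; simp add: d_def del: of_nat_Suc; linarith)+
    moreover have "(real (Suc n) * u i) * d n = u i" for n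
      by (simp add: d_def del: of_nat_Suc)
    ultimately show "\<forall>\<^sub>F n in sequentially. u i - d n \<le> real (?p n i) * d n"
        "\<forall>\<^sub>F n in sequentially. real (?p n i) * d n \<le> u i"
      by (simp_all add: left_diff_distrib del: of_nat_Suc)
    show "(\<lambda>n. u i - d n) \<longlonglongrightarrow> u i" using tendsto_diff[OF tendsto_const d0] by simp
  qed simp
  have q_lim: "(\<lambda>n. real (?q n i) * d n) \<longlonglongrightarrow> v i" if "i \<in> I" for i
  proof (rule tendsto_sandwich)
    have "real (Suc n) * v i \<le> real (?q n i)" "real (?q n i) \<le> real (Suc n) * v i + 1" for n
    proof -
      have "0 \<le> real (Suc n) * v i" using v[OF that] by simp
      then show "real (Suc n) * v i \<le> real (?q n i)" "real (?q n i) \<le> real (Suc n) * v i + 1"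
        by linarith+
    qed
    then show "\<forall>\<^sub>F n in sequentially. v i \<le> real (?q n i) * d n"
        "\<forall>\<^sub>F n in sequentially. real (?q n i) * d n \<le> v i + d n"
      by (auto simp: d_def field_simps simp del: of_nat_Suc)
    show "(\<lambda>n. v i + d n) \<longlonglongrightarrow> v i" using tendsto_add[OF tendsto_const d0] by simp
  qed simp
  show "(\<lambda>n. ?F n x) \<longlonglongrightarrow> of_real (\<Prod>i\<in>I. shc (u i * x) / shc (v i * x))" for x
    by (intro tendsto_of_real tendsto_prod tendsto_divide tendsto_shc tendsto_mult[OF _ tendsto_const] p_lim q_lim) auto
qed

section \<open>Weak submajorisation and sums of positive parts\<close>

text \<open>If \<open>j\<close> entries of \<open>u\<close> exceed \<open>s\<close>, the left side
  is the sum of the \<open>j\<close> largest entries minus \<open>j * s\<close>. Submajorisation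
  bounds it by the same expression for \<open>v\<close>, and passing to positive parts only enlarges
  that.\<close>

lemma weakly_submajorises_sum_max:
  assumes "weakly_submajorises v u"
  shows "(\<Sum>x\<leftarrow>u. max (x - s) 0) \<le> (\<Sum>x\<leftarrow>v. max (x - s) 0)"
proof -
  let ?m = "\<lambda>x. max (x - s) (0::real)"
  define us vs where "us = rev (sort u)" and "vs = rev (sort v)"
  have len: "length us = length vs" 
    and le: "\<And>j. sum_list (take j us) \<le> sum_list (take j vs)"
  proof -
    show len: "length us = length vs"
      using assms by (simp add: weakly_submajorises_def us_def vs_def)
    fix j
    \<comment> \<open>The definition covers \<open>j\<close> from 1 to the length; 0 gives empty
      sums, and beyond the length \<open>take\<close> returns the whole list.\<close>
    have "sum_list (take (min j (length us)) us) \<le> sum_list (take (min j (length us)) vs)"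
    proof (cases "min j (length us) = 0")
      case False
      then have "min j (length us) \<in> {1..length v}"
        using len by (auto simp: us_def vs_def Suc_le_eq)
      then show ?thesis using assms unfolding weakly_submajorises_def us_def vs_def by blast
    qed (simp add: len)
    then show "sum_list (take j us) \<le> sum_list (take j vs)"
      using len by (simp add: min_def split: if_splits)
  qed
  have perm: "(\<Sum>x\<leftarrow>u. ?m x) = (\<Sum>x\<leftarrow>us. ?m x)" "(\<Sum>x\<leftarrow>v. ?m x) = (\<Sum>x\<leftarrow>vs. ?m x)"
    by (simp_all add: us_def vs_def flip: sum_mset_sum_list)
  define j where "j = length (takeWhile (\<lambda>x. s < x) us)"
  have take_us: "take j us = takeWhile (\<lambda>x. s < x) us"
    unfolding j_def by (metis takeWhile_eq_take)
  have drop_us: "drop j us = dropWhile (\<lambda>x. s < x) us"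
    unfolding j_def by (metis dropWhile_eq_drop)
  have jl: "length (take j vs) = length (take j us)" using len by simp
  have shift: "(\<Sum>x\<leftarrow>xs. x - s) = sum_list xs - length xs * s" for xs :: "real list"
    by (induction xs) (auto simp: algebra_simps)
  \<comment> \<open>The first dropped entry fails \<open>s < x\<close>, and by sortedness the later
    ones are no larger.\<close>
  have small: "x \<le> s" if "x \<in> set (drop j us)" for x
  proof -
    have "sorted_wrt (\<ge>) us" unfolding us_def by (simp add: sorted_wrt_rev)
    then have "sorted_wrt (\<ge>) (dropWhile (\<lambda>x. s < x) us)"
      by (metis drop_us sorted_wrt_drop)
    with that show ?thesis
      unfolding drop_us
      by (cases "dropWhile (\<lambda>x. s < x) us") (auto simp: dropWhile_eq_Cons_conv)
  qed
  have "(\<Sum>x\<leftarrow>us. ?m x) = (\<Sum>x\<leftarrow>take j us. ?m x) + (\<Sum>x\<leftarrow>drop j us. ?m x)"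
    by (metis append_take_drop_id map_append sum_list_append)
  also have "(\<Sum>x\<leftarrow>drop j us. ?m x) = (\<Sum>x\<leftarrow>drop j us. 0)"
    using small by (intro arg_cong[where f = sum_list] map_cong) auto
  also have "(\<Sum>x\<leftarrow>take j us. ?m x) = (\<Sum>x\<leftarrow>take j us. x - s)"
    unfolding take_us by (intro arg_cong[where f = sum_list] map_cong) (auto dest: set_takeWhileD)
  also have "\<dots> \<le> (\<Sum>x\<leftarrow>take j vs. x - s)"
    unfolding shift jl using le[of j] by simp
  also have "\<dots> \<le> (\<Sum>x\<leftarrow>take j vs. ?m x)"
    by (intro sum_list_mono) auto
  also have "\<dots> \<le> (\<Sum>x\<leftarrow>take j vs. ?m x) + (\<Sum>x\<leftarrow>drop j vs. ?m x)"
  proof -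
    have "0 \<le> (\<Sum>x\<leftarrow>drop j vs. ?m x)" by (intro sum_list_nonneg) auto
    then show ?thesis by simp
  qed
  also have "\<dots> = (\<Sum>x\<leftarrow>vs. ?m x)"
    by (metis append_take_drop_id map_append sum_list_append)
  finally show ?thesis unfolding perm by simp
qed

section \<open>The functions \<open>f_fun\<close> in the coordinate \<open>t = exp x\<close>\<close>

text \<open>Rests on \<open>exp y - 1 = 2 * exp (y / 2) * sinh (y / 2)\<close> at
  \<open>y = a * x\<close>; with \<open>shc\<close> the formula also covers the logarithm at
  \<open>a = 0\<close>.\<close>

lemma pow_diff_exp: "pow_diff a (exp x) = exp (a * x / 2) * x * shc (a * x / 2)"
proof (cases "a = 0 \<or> x = 0")
  case False
  have "exp (a * x) - 1 = exp (a * x / 2) * (2 * sinh (a * x / 2))"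
    using exp_add[of "a * x / 2" "a * x / 2"] by (simp add: sinh_field_def exp_minus field_simps)
  then show ?thesis
    using False by (simp add: pow_diff_def powr_def sinh_eq_shc)
qed (auto simp: pow_diff_def)

text \<open>The power \<open>gamma_exponent\<close> is what makes all exponential factors combine to
  \<open>exp (x / 2)\<close>, which is free of the parameters and so cancels in quotients of two
  such functions.\<close>

lemma f_fun_exp:
  assumes "length \<alpha> = length \<beta>"
  shows "f_fun \<alpha> \<beta> (exp x) =
    exp (x / 2) * (\<Prod>i<length \<alpha>. shc (\<alpha> ! i * x / 2) / shc (\<beta> ! i * x / 2))"
proof (cases "x = 0")
  case False
  have "(\<Prod>i<length \<alpha>. pow_diff (\<alpha> ! i) (exp x) / pow_diff (\<beta> ! i) (exp x)) =
      (\<Prod>i<length \<alpha>. exp ((\<alpha> ! i - \<beta> ! i) * x / 2) * (shc (\<alpha> ! i * x / 2) / shc (\<beta> ! i * x / 2)))"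
    using False by (intro prod.cong) (auto simp: pow_diff_exp exp_diff diff_divide_distrib left_diff_distrib)
  also have "\<dots> = exp (\<Sum>i<length \<alpha>. (\<alpha> ! i - \<beta> ! i) * x / 2) *
      (\<Prod>i<length \<alpha>. shc (\<alpha> ! i * x / 2) / shc (\<beta> ! i * x / 2))"
    by (simp only: prod.distrib exp_sum finite_lessThan)
  also have "(\<Sum>i<length \<alpha>. (\<alpha> ! i - \<beta> ! i) * x / 2) = (\<Sum>i<length \<alpha>. \<alpha> ! i - \<beta> ! i) * x / 2"
    by (simp add: sum_distrib_right sum_divide_distrib)
  moreover have "exp x powr gamma_exponent \<alpha> \<beta> * exp ((\<Sum>i<length \<alpha>. \<alpha> ! i - \<beta> ! i) * x / 2) = exp (x / 2)"
    unfolding gamma_exponent_def powr_def by (simp add: field_simps flip: exp_add)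
  ultimately show ?thesis
    using False by (simp add: f_fun_def)
qed (simp add: f_fun_def)

lemma f_fun_exp_pos: "length \<alpha> = length \<beta> \<Longrightarrow> 0 < f_fun \<alpha> \<beta> (exp x)"
  by (simp add: f_fun_exp shc_pos prod_pos)

lemma shc_abs: "shc \<bar>y\<bar> = shc y" by (simp add: abs_if)

text \<open>Division by \<open>f_fun \<alpha>' \<beta>'\<close> moves \<open>\<beta>'\<close> to the
  numerator and \<open>\<alpha>'\<close> to the denominator, whence the pairing of the lists;
  \<open>shc\<close> is even, so only absolute values matter.\<close>

lemma f_fun_ratio_char_hull:
  assumes len: "length \<alpha> = length \<beta>" "length \<alpha>' = length \<beta>'"
    and maj: "weakly_submajorises (map abs (\<beta> @ \<alpha>')) (map abs (\<alpha> @ \<beta>'))"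
  shows "(\<lambda>x. of_real (f_fun \<alpha> \<beta> (exp x) / f_fun \<alpha>' \<beta>' (exp x))) \<in> char_hull"
proof -
  define n m where "n = length \<alpha>" and "m = length \<alpha>'"
  let ?u = "\<lambda>i. \<bar>(\<alpha> @ \<beta>') ! i\<bar> / 2" and ?v = "\<lambda>i. \<bar>(\<beta> @ \<alpha>') ! i\<bar> / 2"
  have split: "(\<Prod>i<n + m. g i) = (\<Prod>i<n. g i) * (\<Prod>i<m. g (n + i))" for g :: "nat \<Rightarrow> real"
  proof -
    have "(\<Prod>i<n + m. g i) = (\<Prod>i<n. g i) * (\<Prod>i=n..<n+m. g i)"
      by (subst prod.union_disjoint[symmetric]) (auto intro!: prod.cong)
    also have "(\<Prod>i=n..<n+m. g i) = (\<Prod>i<m. g (n + i))"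
      using prod.shift_bounds_nat_ivl[of g 0 n m] by (simp add: add.commute lessThan_atLeast0)
    finally show ?thesis .
  qed
  have abs: "shc (\<bar>a\<bar> / 2 * x) = shc (a * x / 2)" for a x
    using shc_abs[of "a * x / 2"] shc_abs[of "\<bar>a\<bar> / 2 * x"] by (simp add: abs_mult)
  have ratio: "f_fun \<alpha> \<beta> (exp x) / f_fun \<alpha>' \<beta>' (exp x) = (\<Prod>i<n + m. shc (?u i * x) / shc (?v i * x))" for x
  proof -
    have "f_fun \<alpha> \<beta> (exp x) / f_fun \<alpha>' \<beta>' (exp x) =
       (\<Prod>i<n. shc (\<alpha> ! i * x / 2) / shc (\<beta> ! i * x / 2)) * (\<Prod>i<m. shc (\<beta>' ! i * x / 2) / shc (\<alpha>' ! i * x / 2))"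
      using len by (simp add: f_fun_exp n_def m_def prod_dividef)
    then show ?thesis
      using len unfolding split abs by (simp add: nth_append n_def m_def)
  qed
  \<comment> \<open>The arguments of \<open>shc\<close> carry halved parameters, so threshold
    \<open>s\<close> becomes \<open>2 * s\<close> for the original lists.\<close>
  have list: "(\<Sum>i<n + m. max (\<bar>xs ! i\<bar> / 2 - s) 0) = (\<Sum>x\<leftarrow>map abs xs. max (x - 2 * s) 0) / 2"
    if "length xs = n + m" for xs :: "real list" and s
  proof -
    have "(\<Sum>x\<leftarrow>map abs xs. max (x - 2 * s) 0) = (\<Sum>i<n + m. max (\<bar>xs ! i\<bar> - 2 * s) 0)"
      by (simp add: sum_list_sum_nth that lessThan_atLeast0)
    moreover have "max (\<bar>xs ! i\<bar> / 2 - s) 0 = max (\<bar>xs ! i\<bar> - 2 * s) 0 / 2" for i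
      by (simp add: max_def)
    ultimately show ?thesis by (simp only: sum_divide_distrib)
  qed
  show ?thesis
    unfolding ratio
  proof (rule char_hull_shc_prod)
    fix s :: real
    show "(\<Sum>i<n + m. max (?u i - s) 0) \<le> (\<Sum>i<n + m. max (?v i - s) 0)"
    proof -
      have "length (\<alpha> @ \<beta>') = n + m" "length (\<beta> @ \<alpha>') = n + m"
        using len by (simp_all add: n_def m_def)
      then show ?thesis
        using weakly_submajorises_sum_max[OF maj, of "2 * s"] by (simp only: list)
    qed
  qed auto
qed

section \<open>Spectral decomposition and functional calculus\<close>

definition cdot :: "complex^'n \<Rightarrow> complex^'n \<Rightarrow> complex" where
  "cdot x y = (\<Sum>i\<in>UNIV. x $ i * cnj (y $ i))"

lemma Re_cdot: "Re (cdot x y) = x \<bullet> y"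
  by (simp add: cdot_def inner_vec_def inner_complex_def)

lemma cdot_adjoint: "cdot (A *v x) y = cdot x (cadjoint A *v y)"
proof -
  have "cdot (A *v x) y = (\<Sum>i\<in>UNIV. \<Sum>j\<in>UNIV. A $ i $ j * x $ j * cnj (y $ i))"
    by (simp add: cdot_def matrix_vector_mult_def sum_distrib_right)
  also have "\<dots> = (\<Sum>j\<in>UNIV. \<Sum>i\<in>UNIV. A $ i $ j * x $ j * cnj (y $ i))"
    by (rule sum.swap)
  finally show ?thesis
    by (simp add: cdot_def matrix_vector_mult_def sum_distrib_left cadjoint_def mult_ac)
qed

lemma cdot_add_left: "cdot (x + y) z = cdot x z + cdot y z"
  by (simp add: cdot_def ring_distribs sum.distrib)

lemma cdot_diff_left: "cdot (x - y) z = cdot x z - cdot y z"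
  by (simp add: cdot_def ring_distribs sum_subtractf)

lemma cdot_scaleR_left: "cdot (r *\<^sub>R x) z = of_real r * cdot x z"
  by (simp add: cdot_def sum_distrib_left scaleR_conv_of_real[where 'a = complex] mult.assoc)

lemma cdot_scaleR_right: "cdot x (r *\<^sub>R z) = of_real r * cdot x z"
  by (simp add: cdot_def sum_distrib_left scaleR_conv_of_real[where 'a = complex] mult_ac)

lemma cdot_commute: "cdot y x = cnj (cdot x y)"
  by (simp add: cdot_def mult.commute)

lemma continuous_on_cdot_left: "continuous_on S (\<lambda>x. cdot x y)"
  unfolding cdot_def by (intro continuous_intros)

lemma matrix_vector_scaleR: "A *v (r *\<^sub>R x) = r *\<^sub>R (A *v x)" for A :: "complex^'n^'m"
  by (simp add: vec_eq_iff matrix_vector_mult_def scaleR_sum_right)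

lemma continuous_on_matrix_vector: "continuous_on S (\<lambda>x. A *v x)" for A :: "complex^'n^'m"
  unfolding matrix_vector_mult_def by (intro continuous_intros)

lemma cdot_add_right: "cdot x (y + z) = cdot x y + cdot x z"
  by (simp add: cdot_def ring_distribs sum.distrib)

lemma cdot_axis_right: "cdot x (axis j c) = x $ j * cnj c"
proof -
  have "cdot x (axis j c) = (\<Sum>k\<in>UNIV. if k = j then x $ k * cnj c else 0)"
    unfolding cdot_def by (intro sum.cong) (auto simp: axis_def)
  then show ?thesis by simp
qed

lemma matrix_vector_axis: "(A *v axis i c) $ k = A $ k $ i * c" for A :: "complex^'n^'m"
proof -
  have "(A *v axis i c) $ k = (\<Sum>l\<in>UNIV. if l = i then A $ k $ l * c else 0)"
    unfolding matrix_vector_mult_def vec_lambda_beta by (intro sum.cong) (auto simp: axis_def)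
  then show ?thesis by simp
qed

text \<open>Polarisation: the form is real at \<open>axis i 1 + axis j c\<close>. Taking
  \<open>c = 1\<close> compares the imaginary parts of the two mirrored entries,
  \<open>c = \<i>\<close> their real parts.\<close>

lemma positive_matrix_hermitian:
  assumes "positive_matrix A"
  shows "cadjoint A = A"
proof -
  have real: "Im (cdot (A *v x) x) = 0" for x
  proof -
    have "cdot (A *v x) x \<in> \<real>\<^sub>\<ge>\<^sub>0"
      using assms unfolding positive_matrix_def cdot_def by blast
    then show ?thesis by (simp only: complex_nonneg_Reals_iff)
  qed
  have diag: "Im (A $ k $ k) = 0" for k
    using real[of "axis k 1"] by (simp add: cdot_axis_right matrix_vector_axis)
  have "cnj (A $ j $ i) = A $ i $ j" for i j
  proof -
    have expand: "cdot (A *v (axis i 1 + axis j c)) (axis i 1 + axis j c) =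
        A $ i $ i + A $ i $ j * c + A $ j $ i * cnj c + A $ j $ j * (c * cnj c)" for c
      by (simp only: cdot_axis_right matrix_vector_axis matrix_vector_right_distrib cdot_add_left
          cdot_add_right vector_add_component) (simp add: algebra_simps)
    have "Im (A $ i $ j) + Im (A $ j $ i) = 0"
      using real[of "axis i 1 + axis j 1"] unfolding expand by (simp add: diag)
    moreover have "Re (A $ i $ j) - Re (A $ j $ i) = 0"
      using real[of "axis i 1 + axis j \<i>"] unfolding expand by (simp add: diag)
    ultimately show ?thesis by (intro complex_eqI) auto
  qed
  then show ?thesis by (simp add: cadjoint_def vec_eq_iff)
qed

text \<open>A square matrix whose rows are the conjugated \<open>b i\<close> for
  \<open>i \<in> J\<close> has a zero row at \<open>j\<close>, hence is singular; a kernel vector is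
  the required \<open>x\<close>.\<close>

lemma exists_orthogonal_nonzero:
  fixes b :: "'n::finite \<Rightarrow> complex^'n"
  assumes "j \<notin> J"
  shows "\<exists>x. x \<noteq> 0 \<and> (\<forall>i\<in>J. cdot x (b i) = 0)"
proof -
  define Z :: "complex^'n^'n" where "Z = (\<chi> i k. if i \<in> J then cnj (b i $ k) else 0)"
  have "\<not> (\<exists>B. B ** Z = mat 1)"
  proof
    assume "\<exists>B. B ** Z = mat 1"
    then obtain B where "Z ** B = mat 1" using matrix_left_right_inverse by blast
    moreover have "(Z ** B) $ j $ j = 0" using assms by (simp add: matrix_matrix_mult_def Z_def)
    ultimately show False by (simp add: mat_def)
  qed
  then obtain x where x: "Z *v x = 0" "x \<noteq> 0"
    unfolding matrix_left_invertible_ker by blast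
  have "cdot x (b i) = 0" if "i \<in> J" for i
  proof -
    have "(Z *v x) $ i = cdot x (b i)"
      using that by (simp add: matrix_vector_mult_def Z_def cdot_def mult.commute)
    then show ?thesis using x by simp
  qed
  then show ?thesis using x by blast
qed

text \<open>The eigenvector maximises the quadratic form on the unit sphere of the complement.\<close>

lemma hermitian_eigenvector_in_complement:
  fixes A :: "complex^'n^'n" and j :: 'n
  assumes herm: "cadjoint A = A" and j: "j \<notin> J"
    and eig: "\<And>i. i \<in> J \<Longrightarrow> A *v b i = l i *\<^sub>R b i"
  shows "\<exists>x r. A *v x = r *\<^sub>R x \<and> cdot x x = 1 \<and> (\<forall>i\<in>J. cdot x (b i) = 0)"
proof -
  define W where "W = {x. \<forall>i\<in>J. cdot x (b i) = 0}"
  define g where "g = (\<lambda>x. (A *v x) \<bullet> x)"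
  have W_add: "x + y \<in> W" and W_diff: "x - y \<in> W" and W_scale: "r *\<^sub>R x \<in> W"
    if "x \<in> W" "y \<in> W" for x y r
    using that by (auto simp: W_def cdot_add_left cdot_diff_left cdot_scaleR_left)
  \<comment> \<open>The complement is invariant because \<open>A\<close> is self-adjoint and each
    \<open>b i\<close> is an eigenvector with a real eigenvalue.\<close>
  have W_A: "A *v x \<in> W" if "x \<in> W" for x
    using that by (auto simp: W_def cdot_adjoint herm eig cdot_scaleR_right)
  have "W = (\<Inter>i\<in>J. {x. cdot x (b i) = 0})" by (auto simp: W_def)
  also have "closed \<dots>"
    by (intro closed_INT ballI closed_Collect_eq continuous_on_cdot_left continuous_on_const)
  finally have "compact (sphere 0 1 \<inter> W)" by (intro compact_Int_closed compact_sphere)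
  moreover have "sphere 0 1 \<inter> W \<noteq> {}"
  proof -
    obtain x where x: "x \<noteq> 0" "x \<in> W"
      using exists_orthogonal_nonzero[OF j] unfolding W_def by blast
    then have "inverse (norm x) *\<^sub>R x \<in> sphere 0 1 \<inter> W" using W_scale[OF x(2) x(2)] by simp
    then show ?thesis by blast
  qed
  moreover have "continuous_on (sphere 0 1 \<inter> W) g"
    unfolding g_def by (intro continuous_intros continuous_on_matrix_vector)
  ultimately obtain x where x: "x \<in> sphere 0 1 \<inter> W" and max: "\<And>y. y \<in> sphere 0 1 \<inter> W \<Longrightarrow> g y \<le> g x"
    using continuous_attains_sup[of "sphere 0 1 \<inter> W" g] by blast
  define r where "r = g x"
  \<comment> \<open>By homogeneity the maximum on the sphere bounds the form on all of
    \<open>W\<close>.\<close>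
  have g_le: "g y \<le> r * (y \<bullet> y)" if "y \<in> W" for y
  proof (cases "y = 0")
    case False
    define u where "u = inverse (norm y) *\<^sub>R y"
    have "u \<in> sphere 0 1 \<inter> W" using False W_scale[OF that that] by (simp add: u_def)
    then have "g u \<le> r" using max by (simp add: r_def)
    have "norm y *\<^sub>R u = y" using False by (simp add: u_def)
    then have "g y = g (norm y *\<^sub>R u)" by (simp only:)
    also have "\<dots> = (norm y)\<^sup>2 * g u"
      by (simp add: g_def matrix_vector_scaleR power2_eq_square)
    also have "\<dots> \<le> (norm y)\<^sup>2 * r"
      using \<open>g u \<le> r\<close> by (rule mult_left_mono) simp
    finally show ?thesis by (simp only: dot_square_norm mult.commute)
  qed (simp add: g_def)
  define w where "w = A *v x - r *\<^sub>R x"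
  have w: "w \<in> W" unfolding w_def using x by (intro W_diff W_A W_scale) auto
  have sym: "x \<bullet> (A *v w) = w \<bullet> (A *v x)"
  proof -
    have "x \<bullet> (A *v w) = Re (cdot (A *v x) w)" by (simp only: Re_cdot[symmetric] cdot_adjoint herm)
    then show ?thesis by (simp only: Re_cdot inner_commute)
  qed
  define C where "C = r * (w \<bullet> w) - g w"
  have "C \<ge> 0" using g_le[OF w] by (simp add: C_def)
  \<comment> \<open>First variation: comparing \<open>x\<close> with
    \<open>x + t *\<^sub>R w\<close>, where \<open>w\<close> is the residual, cancels the constant
    terms. A linear bound by a quadratic for all \<open>t\<close> forces
    \<open>w = 0\<close>.\<close>
  have le: "2 * t * (w \<bullet> w) \<le> t\<^sup>2 * C" for t
  proof -
    have "g (x + t *\<^sub>R w) \<le> r * ((x + t *\<^sub>R w) \<bullet> (x + t *\<^sub>R w))"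
      using x w by (intro g_le W_add W_scale) auto
    moreover have "g (x + t *\<^sub>R w) = r + 2 * t * ((A *v x) \<bullet> w) + t\<^sup>2 * g w"
      by (simp add: g_def r_def matrix_vector_right_distrib matrix_vector_scaleR inner_add_left inner_add_right
          sym power2_eq_square inner_commute algebra_simps)
    moreover have "x \<bullet> x = 1" using x by (simp add: dot_square_norm)
    moreover have "(A *v x) \<bullet> w = w \<bullet> w + r * (x \<bullet> w)"
      by (simp add: w_def inner_diff_left inner_diff_right inner_commute algebra_simps)
    ultimately show ?thesis
      by (simp add: C_def inner_add_left inner_add_right inner_commute power2_eq_square algebra_simps)
  qed
  have "w \<bullet> w = 0"
  proof (rule ccontr)
    assume "w \<bullet> w \<noteq> 0"
    then have D: "w \<bullet> w > 0" by simp
    \<comment> \<open>Small enough for the linear term to win; \<open>C + 1\<close> is positive even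
      if \<open>C = 0\<close>.\<close>
    let ?t = "(w \<bullet> w) / (C + 1)"
    have "2 * ?t * (w \<bullet> w) \<le> ?t * (?t * C)" using le[of ?t] by (simp add: power2_eq_square)
    moreover have "?t > 0" using D \<open>C \<ge> 0\<close> by simp
    ultimately have "2 * (w \<bullet> w) \<le> ?t * C"
      by (simp only: mult.assoc mult.left_commute[of 2] mult_le_cancel_left_pos)
    moreover have "?t * C \<le> w \<bullet> w" using D \<open>C \<ge> 0\<close> by (simp add: field_simps)
    ultimately show False using D by simp
  qed
  then have "A *v x = r *\<^sub>R x" by (simp add: w_def)
  moreover have "cdot x x = 1"
  proof -
    have "Re (cdot x x) = 1" using x by (simp add: Re_cdot dot_square_norm)
    moreover have "Im (cdot x x) = 0" using cdot_commute[of x x] by (simp add: complex_eq_iff)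
    ultimately show ?thesis by (simp add: complex_eq_iff)
  qed
  ultimately show ?thesis using x by (auto simp: W_def)
qed

text \<open>Each induction step adds an eigenvector from the orthogonal complement of those already
  found. Indexing by coordinates makes the family over \<open>UNIV\<close> the columns of a square
  matrix.\<close>

lemma hermitian_orthonormal_eigenvectors:
  fixes A :: "complex^'n^'n" and J :: "'n set"
  assumes "cadjoint A = A"
  shows "\<exists>b l. \<forall>i\<in>J. A *v b i = l i *\<^sub>R b i \<and> (\<forall>k\<in>J. cdot (b i) (b k) = (if i = k then 1 else 0))"
  using finite[of J]
proof (induction J rule: finite_induct)
  case (insert j J)
  then obtain b l where b: "\<And>i. i \<in> J \<Longrightarrow> A *v b i = l i *\<^sub>R b i"
      "\<And>i k. i \<in> J \<Longrightarrow> k \<in> J \<Longrightarrow> cdot (b i) (b k) = (if i = k then 1 else 0)"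
    by blast
  obtain x r where x: "A *v x = r *\<^sub>R x" "cdot x x = 1" "\<And>i. i \<in> J \<Longrightarrow> cdot x (b i) = 0"
    using hermitian_eigenvector_in_complement[OF assms insert(2), of b l] b(1) by blast
  have "cdot (b i) x = 0" if "i \<in> J" for i
    using x(3)[OF that] cdot_commute[of "b i" x] by simp
  then show ?case
    using b x insert(2) by (intro exI[of _ "b(j := x)"] exI[of _ "l(j := r)"]) auto
qed simp

section \<open>Unitary diagonalisation\<close>

definition diag_matrix :: "('n \<Rightarrow> complex) \<Rightarrow> complex^'n^'n" where
  "diag_matrix d = (\<chi> i j. if i = j then d i else 0)"

lemma diag_matrix_mult_left: "(diag_matrix d ** X) $ i $ j = d i * X $ i $ j"
  by (simp add: diag_matrix_def matrix_matrix_mult_def if_distrib[of "\<lambda>z. z * _"] cong: if_cong)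

lemma diag_matrix_mult_right: "(X ** diag_matrix d) $ i $ j = X $ i $ j * d j"
  by (simp add: diag_matrix_def matrix_matrix_mult_def if_distrib[of "\<lambda>z. _ * z"] cong: if_cong)

lemma cadjoint_mult: "cadjoint (A ** B) = cadjoint B ** cadjoint A"
  by (simp add: cadjoint_def matrix_matrix_mult_def vec_eq_iff mult.commute)

lemma cadjoint_cadjoint [simp]: "cadjoint (cadjoint A) = A"
  by (simp add: cadjoint_def vec_eq_iff)

lemma unitary_cadjoint: "unitary_matrix U \<Longrightarrow> unitary_matrix (cadjoint U)"
  by (simp add: unitary_matrix_def)

lemma unitary_diag_cis: "unitary_matrix (diag_matrix (\<lambda>i. cis (d i)))"
proof -
  have "cadjoint (diag_matrix (\<lambda>i. cis (d i))) = diag_matrix (\<lambda>i. cis (- d i))"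
    by (simp add: cadjoint_def diag_matrix_def vec_eq_iff cis_cnj)
  note adj = this
  show ?thesis
    unfolding unitary_matrix_def adj
    by (simp only: vec_eq_iff diag_matrix_mult_left) (simp add: diag_matrix_def mat_def cis_mult)
qed

text \<open>The columns of \<open>U\<close> are orthonormal eigenvectors. Each \<open>h i\<close> is
  the value of the form at \<open>b i\<close>, hence nonnegative, and it cannot vanish because
  \<open>A\<close> has trivial kernel.\<close>

lemma positive_invertible_diagonalization:
  fixes A :: "complex^'n^'n"
  assumes pos: "positive_matrix A" and inv: "invertible A"
  obtains U h where "unitary_matrix U" "\<And>i. 0 < h i"
    "A = U ** diag_matrix (\<lambda>i. of_real (h i)) ** cadjoint U"
proof -
  obtain b :: "'n \<Rightarrow> complex^'n" and h where eig: "\<And>i. A *v b i = h i *\<^sub>R b i"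
      and orth: "\<And>i k. cdot (b i) (b k) = (if i = k then 1 else 0)"
    using hermitian_orthonormal_eigenvectors[OF positive_matrix_hermitian[OF pos], of UNIV] by blast
  define U where "U = (\<chi> i j. b j $ i)"
  have "cadjoint U ** U = mat 1"
    using orth by (simp add: U_def cadjoint_def matrix_matrix_mult_def mat_def vec_eq_iff cdot_def mult.commute)
  then have U: "unitary_matrix U"
    unfolding unitary_matrix_def using matrix_left_right_inverse by blast
  have "A ** U = U ** diag_matrix (\<lambda>i. of_real (h i))"
  proof -
    have "(A ** U) $ i $ j = (A *v b j) $ i" for i j
      by (simp add: matrix_matrix_mult_def matrix_vector_mult_def U_def)
    then show ?thesis
      by (simp add: vec_eq_iff diag_matrix_mult_right eig U_def scaleR_conv_of_real[where 'a = complex] mult.commute)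
  qed
  then have A: "A = U ** diag_matrix (\<lambda>i. of_real (h i)) ** cadjoint U"
    by (metis U matrix_mul_assoc matrix_mul_rid unitary_matrix_def)
  have "0 < h i" for i
  proof -
    have "cdot (A *v b i) (b i) = of_real (h i)" by (simp add: eig cdot_scaleR_left orth)
    moreover have "cdot (A *v b i) (b i) \<in> \<real>\<^sub>\<ge>\<^sub>0"
      using pos by (simp add: positive_matrix_def cdot_def)
    ultimately have "0 \<le> h i" by (simp add: complex_nonneg_Reals_iff)
    moreover have "h i \<noteq> 0"
    proof
      assume "h i = 0"
      then have "A *v b i = 0" by (simp add: eig)
      then have "b i = 0" using inv by (metis invertible_left_inverse matrix_left_invertible_ker)
      then show False using orth[of i i] by (simp add: cdot_def)
    qed
    ultimately show ?thesis by simp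
  qed
  with U A show ?thesis using that by blast
qed

section \<open>Functional calculus as entrywise multiplication\<close>

definition schur_mult :: "('n \<Rightarrow> 'n \<Rightarrow> complex) \<Rightarrow> complex^'n^'n \<Rightarrow> complex^'n^'n" where
  "schur_mult m Y = (\<chi> i j. m i j * Y $ i $ j)"

lemma schur_mult_schur_mult: "schur_mult m (schur_mult m' Y) = schur_mult (\<lambda>i j. m i j * m' i j) Y"
  by (simp add: schur_mult_def vec_eq_iff mult.assoc)

lemma hs_inner_sum: "hs_inner X Y = (\<Sum>j\<in>UNIV. \<Sum>i\<in>UNIV. X $ i $ j * cnj (Y $ i $ j))"
  by (simp add: hs_inner_def trace_def cadjoint_def matrix_matrix_mult_def mult.commute)

lemma hs_inner_self_zero:
  assumes "hs_inner X X = 0"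
  shows "X = 0"
proof -
  have "hs_inner X X = of_real (\<Sum>j\<in>UNIV. \<Sum>i\<in>UNIV. (cmod (X $ i $ j))\<^sup>2)"
    by (simp only: hs_inner_sum complex_norm_square of_real_sum)
  with assms have "(\<Sum>j\<in>UNIV. \<Sum>i\<in>UNIV. (cmod (X $ i $ j))\<^sup>2) = 0" by (metis of_real_eq_0_iff)
  then show ?thesis by (simp add: sum_nonneg_eq_0_iff sum_nonneg vec_eq_iff)
qed

lemma hs_inner_diff_left: "hs_inner (X - Y) Z = hs_inner X Z - hs_inner Y Z"
  by (simp add: hs_inner_sum ring_distribs sum_subtractf)

text \<open>Two candidates differ by an element of \<open>S\<close> that is orthogonal to itself,
  hence zero.\<close>

lemma orth_projection_eqI:
  assumes Y: "Y \<in> S" and orth: "\<And>Z. Z \<in> S \<Longrightarrow> hs_inner (X - Y) Z = 0"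
    and diff: "\<And>Z Z'. Z \<in> S \<Longrightarrow> Z' \<in> S \<Longrightarrow> Z - Z' \<in> S"
  shows "orth_projection S X = Y"
  unfolding orth_projection_def
proof (rule the_equality)
  fix Y' assume Y': "Y' \<in> S \<and> (\<forall>Z\<in>S. hs_inner (X - Y') Z = 0)"
  then have "Y - Y' \<in> S" using Y diff by blast
  then have "hs_inner (X - Y') (Y - Y') - hs_inner (X - Y) (Y - Y') = 0"
    using Y' orth by simp
  then have "hs_inner (Y - Y') (Y - Y') = 0" by (simp flip: hs_inner_diff_left)
  then show "Y' = Y" using hs_inner_self_zero[of "Y - Y'"] by simp
qed (use Y orth in blast)

text \<open>In the coordinates \<open>Y\<close> the eigenspace for \<open>l\<close> consists of the
  matrices supported where \<open>r i j = l\<close>. Its projection is therefore a 0-1 mask, and the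
  masks weighted by \<open>f l\<close> add up to the multiplier \<open>f (r i j)\<close>.\<close>

lemma fun_calculus_diagonal:
  fixes U V :: "complex^'n^'n"
  assumes U: "unitary_matrix U" and V: "unitary_matrix V"
    and T: "\<And>Y. T (U ** Y ** cadjoint V) = U ** schur_mult (\<lambda>i j. of_real (r i j)) Y ** cadjoint V"
  shows "fun_calculus f T (U ** Y ** cadjoint V) = U ** schur_mult (\<lambda>i j. of_real (f (r i j))) Y ** cadjoint V"
proof -
  define \<Phi> where "\<Phi> = (\<lambda>Y. U ** Y ** cadjoint V)"
  define \<Psi> where "\<Psi> = (\<lambda>X. cadjoint U ** X ** V)"
  have UU: "cadjoint U ** U = mat 1" "U ** cadjoint U = mat 1"
    and VV: "cadjoint V ** V = mat 1" "V ** cadjoint V = mat 1"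
    using U V by (auto simp: unitary_matrix_def)
  have \<Psi>\<Phi>: "\<Psi> (\<Phi> Y) = Y" for Y
  proof -
    have "\<Psi> (\<Phi> Y) = (cadjoint U ** U) ** Y ** (cadjoint V ** V)"
      by (simp add: \<Phi>_def \<Psi>_def matrix_mul_assoc)
    then show ?thesis by (simp add: UU VV)
  qed
  have \<Phi>\<Psi>: "\<Phi> (\<Psi> X) = X" for X
  proof -
    have "\<Phi> (\<Psi> X) = (U ** cadjoint U) ** X ** (V ** cadjoint V)"
      by (simp add: \<Phi>_def \<Psi>_def matrix_mul_assoc)
    then show ?thesis by (simp add: UU VV)
  qed
  have \<Phi>_inj: "\<Phi> Y = \<Phi> Z \<longleftrightarrow> Y = Z" for Y Z by (metis \<Psi>\<Phi>)
  have \<Phi>_entry: "\<Phi> Y $ i $ j = (\<Sum>l\<in>UNIV. (\<Sum>k\<in>UNIV. U $ i $ k * Y $ k $ l) * cadjoint V $ l $ j)" for Y i j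
    by (simp add: \<Phi>_def matrix_matrix_mult_def)
  have \<Phi>_lin: "linear \<Phi>"
    by (rule linearI)
       (simp_all add: vec_eq_iff \<Phi>_entry ring_distribs sum.distrib scaleR_sum_right sum_distrib_right)
  \<comment> \<open>Cyclicity of the trace makes the coordinate change an isometry, so orthogonality
    can be read off entries.\<close>
  have hs: "hs_inner (\<Phi> Y) (\<Phi> Z) = hs_inner Y Z" for Y Z
  proof -
    have "hs_inner (\<Phi> Y) (\<Phi> Z) = trace (V ** (cadjoint Z ** (cadjoint U ** U) ** Y ** cadjoint V))"
      by (simp add: hs_inner_def \<Phi>_def cadjoint_mult matrix_mul_assoc)
    also have "\<dots> = trace (cadjoint Z ** (cadjoint U ** U) ** Y ** cadjoint V ** V)"
      by (rule trace_mul_sym)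
    also have "\<dots> = trace (cadjoint Z ** (cadjoint U ** U) ** Y ** (cadjoint V ** V))"
      by (simp only: matrix_mul_assoc)
    finally show ?thesis by (simp add: UU VV hs_inner_def)
  qed
  have eig: "\<Phi> Y \<in> op_eigenspace T l \<longleftrightarrow> (\<forall>i j. Y $ i $ j \<noteq> 0 \<longrightarrow> r i j = l)" for Y l
  proof -
    have "\<Phi> Y \<in> op_eigenspace T l \<longleftrightarrow> \<Phi> (schur_mult (\<lambda>i j. of_real (r i j)) Y) = \<Phi> (l *\<^sub>R Y)"
      unfolding op_eigenspace_def linear_scale[OF \<Phi>_lin] using T by (simp add: \<Phi>_def)
    also have "\<dots> \<longleftrightarrow> (\<forall>i j. of_real (r i j) * Y $ i $ j = of_real l * Y $ i $ j)"
      unfolding \<Phi>_inj by (simp add: vec_eq_iff schur_mult_def scaleR_conv_of_real[where 'a = complex])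
    finally show ?thesis by auto
  qed
  have spec: "op_spectrum T = (\<lambda>(i, j). r i j) ` UNIV"
  proof (intro set_eqI iffI)
    fix l assume "l \<in> op_spectrum T"
    then obtain X where X: "X \<noteq> 0" "X \<in> op_eigenspace T l" by (auto simp: op_spectrum_def)
    have "\<Psi> X \<noteq> 0" using X(1) \<Phi>\<Psi>[of X] linear_0[OF \<Phi>_lin] by metis
    then obtain i j where "\<Psi> X $ i $ j \<noteq> 0" by (auto simp: vec_eq_iff)
    then have "r i j = l" using eig[of "\<Psi> X" l] X(2) \<Phi>\<Psi> by simp
    then show "l \<in> (\<lambda>(i, j). r i j) ` UNIV" by force
  next
    fix l assume "l \<in> (\<lambda>(i, j). r i j) ` UNIV"
    then obtain i j where l: "l = r i j" by auto
    let ?E = "(\<chi> i' j'. if i' = i \<and> j' = j then 1 else 0) :: complex^'n^'n"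
    have "\<Phi> ?E \<in> op_eigenspace T l" unfolding eig using l by simp
    moreover have "?E \<noteq> 0" by (auto simp: vec_eq_iff)
    then have "\<Phi> ?E \<noteq> 0" using \<Phi>_inj[of ?E 0] linear_0[OF \<Phi>_lin] by simp
    ultimately show "l \<in> op_spectrum T" by (auto simp: op_spectrum_def)
  qed
  have proj: "orth_projection (op_eigenspace T l) (\<Phi> Y) = \<Phi> (schur_mult (\<lambda>i j. if r i j = l then 1 else 0) Y)" for l
  proof (rule orth_projection_eqI)
    show "\<Phi> (schur_mult (\<lambda>i j. if r i j = l then 1 else 0) Y) \<in> op_eigenspace T l"
      by (simp add: eig schur_mult_def)
    fix Z assume Z: "Z \<in> op_eigenspace T l"
    have "hs_inner (\<Phi> (Y - schur_mult (\<lambda>i j. if r i j = l then 1 else 0) Y)) (\<Phi> (\<Psi> Z)) = 0"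
      unfolding hs using Z eig[of "\<Psi> Z" l]
      by (auto simp: \<Phi>\<Psi> hs_inner_sum schur_mult_def intro!: sum.neutral)
    then show "hs_inner (\<Phi> Y - \<Phi> (schur_mult (\<lambda>i j. if r i j = l then 1 else 0) Y)) Z = 0"
      by (simp add: \<Phi>\<Psi> linear_diff[OF \<Phi>_lin])
    fix Z' assume Z': "Z' \<in> op_eigenspace T l"
    have "\<Phi> (\<Psi> Z - \<Psi> Z') \<in> op_eigenspace T l"
    proof -
      have "\<forall>i j. \<Psi> Z $ i $ j \<noteq> 0 \<longrightarrow> r i j = l" "\<forall>i j. \<Psi> Z' $ i $ j \<noteq> 0 \<longrightarrow> r i j = l"
        using Z Z' eig[of "\<Psi> Z" l] eig[of "\<Psi> Z'" l] by (simp_all add: \<Phi>\<Psi>)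
      then show ?thesis unfolding eig by (metis diff_self vector_minus_component)
    qed
    then show "Z - Z' \<in> op_eigenspace T l" by (simp add: \<Phi>\<Psi> linear_diff[OF \<Phi>_lin])
  qed
  have "fun_calculus f T (\<Phi> Y) = \<Phi> (\<Sum>l\<in>op_spectrum T. f l *\<^sub>R schur_mult (\<lambda>i j. if r i j = l then 1 else 0) Y)"
    unfolding fun_calculus_def proj linear_sum[OF \<Phi>_lin] linear_scale[OF \<Phi>_lin] ..
  also have "(\<Sum>l\<in>op_spectrum T. f l *\<^sub>R schur_mult (\<lambda>i j. if r i j = l then 1 else 0) Y) =
      schur_mult (\<lambda>i j. of_real (f (r i j))) Y"
  proof -
    \<comment> \<open>Only \<open>l = r i j\<close> contributes, and \<open>spec\<close> says that
      it occurs in the sum.\<close>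
    have "(\<Sum>l\<in>op_spectrum T. f l *\<^sub>R ((if r i j = l then 1 else 0) * Y $ i $ j)) = of_real (f (r i j)) * Y $ i $ j" for i j
    proof -
      have "(\<Sum>l\<in>op_spectrum T. f l *\<^sub>R ((if r i j = l then 1 else 0) * Y $ i $ j)) =
          (\<Sum>l\<in>op_spectrum T. if r i j = l then f l *\<^sub>R Y $ i $ j else 0)"
        by (intro sum.cong) auto
      also have "\<dots> = of_real (f (r i j)) * Y $ i $ j"
        unfolding spec by (subst sum.delta') (auto simp: scaleR_conv_of_real[where 'a = complex])
      finally show ?thesis .
    qed
    then show ?thesis by (simp add: vec_eq_iff schur_mult_def)
  qed
  finally show ?thesis unfolding \<Phi>_def .
qed

text \<open>In these coordinates \<open>L_op H\<close> multiplies entry \<open>(i, j)\<close> by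
  \<open>h i\<close> and \<open>R_op K\<close> multiplies it by \<open>k j\<close>, so the operator
  inside the functional calculus has multiplier \<open>h i / k j\<close>.\<close>

lemma M_op_diagonal:
  fixes U V :: "complex^'n^'n"
  assumes U: "unitary_matrix U" and V: "unitary_matrix V" and k: "\<And>j. 0 < k j"
    and H: "H = U ** diag_matrix (\<lambda>i. of_real (h i)) ** cadjoint U"
    and K: "K = V ** diag_matrix (\<lambda>j. of_real (k j)) ** cadjoint V"
  shows "M_op \<alpha> \<beta> H K (U ** Y ** cadjoint V) =
    U ** schur_mult (\<lambda>i j. of_real (k j * f_fun \<alpha> \<beta> (h i / k j))) Y ** cadjoint V"
proof -
  have UU: "cadjoint U ** U = mat 1" "U ** cadjoint U = mat 1"
    and VV: "cadjoint V ** V = mat 1" "V ** cadjoint V = mat 1"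
    using U V by (auto simp: unitary_matrix_def)
  have right: "(U ** Y ** cadjoint V) ** (V ** diag_matrix d ** cadjoint V) = U ** schur_mult (\<lambda>i j. d j) Y ** cadjoint V"
    for d Y
  proof -
    have "(U ** Y ** cadjoint V) ** (V ** diag_matrix d ** cadjoint V) =
        U ** (Y ** (cadjoint V ** V) ** diag_matrix d) ** cadjoint V"
      by (simp only: matrix_mul_assoc)
    also have "Y ** (cadjoint V ** V) ** diag_matrix d = schur_mult (\<lambda>i j. d j) Y"
      by (simp add: VV vec_eq_iff diag_matrix_mult_right schur_mult_def mult.commute)
    finally show ?thesis .
  qed
  have left: "(U ** diag_matrix d ** cadjoint U) ** (U ** Y ** cadjoint V) = U ** schur_mult (\<lambda>i j. d i) Y ** cadjoint V"
    for d Y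
  proof -
    have "(U ** diag_matrix d ** cadjoint U) ** (U ** Y ** cadjoint V) =
        U ** (diag_matrix d ** ((cadjoint U ** U) ** Y)) ** cadjoint V"
      by (simp only: matrix_mul_assoc)
    also have "diag_matrix d ** ((cadjoint U ** U) ** Y) = schur_mult (\<lambda>i j. d i) Y"
      by (simp add: UU vec_eq_iff diag_matrix_mult_left schur_mult_def)
    finally show ?thesis .
  qed
  have inv: "inv (R_op K) (U ** Y ** cadjoint V) = U ** schur_mult (\<lambda>i j. of_real (1 / k j)) Y ** cadjoint V" for Y
  proof (rule inv_f_eq)
    have "invertible K"
    proof -
      have e: "(V ** D ** cadjoint V) ** (V ** D' ** cadjoint V) = V ** (D ** ((cadjoint V ** V) ** D')) ** cadjoint V" for D D'
        by (simp only: matrix_mul_assoc)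
      have "diag_matrix (\<lambda>j. of_real (k j)) ** diag_matrix (\<lambda>j. of_real (1 / k j)) = (mat 1 :: complex^'n^'n)"
        using k by (simp add: vec_eq_iff diag_matrix_mult_left) (simp add: diag_matrix_def mat_def less_imp_neq[symmetric])
      then have "K ** (V ** diag_matrix (\<lambda>j. of_real (1 / k j)) ** cadjoint V) = mat 1"
        unfolding K e by (simp add: VV)
      then show ?thesis unfolding invertible_right_inverse by blast
    qed
    then obtain K' where "K ** K' = mat 1" unfolding invertible_right_inverse by blast
    then have "R_op K' (R_op K X) = X" for X by (simp add: R_op_def flip: matrix_mul_assoc)
    then show "inj (R_op K)" by (rule inj_on_inverseI)
    show "R_op K (U ** schur_mult (\<lambda>i j. of_real (1 / k j)) Y ** cadjoint V) = U ** Y ** cadjoint V"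
      unfolding R_op_def K right using k
      by (simp add: schur_mult_schur_mult less_imp_neq[symmetric]) (simp add: schur_mult_def)
  qed
  have T: "(L_op H \<circ> inv (R_op K)) (U ** Y ** cadjoint V) = U ** schur_mult (\<lambda>i j. of_real (h i / k j)) Y ** cadjoint V" for Y
    unfolding o_def inv L_op_def H left by (simp add: schur_mult_schur_mult)
  show ?thesis
    by (simp only: M_op_def o_apply[of "R_op K"] fun_calculus_diagonal[OF U V T])
       (simp add: R_op_def K right schur_mult_schur_mult)
qed

section \<open>Action of the hull on kernels and matrices\<close>

text \<open>With an arbitrary kernel \<open>B\<close> in place of \<open>1\<close>, the product rule of the hull needs no Schur product
  theorem: it is just iteration.\<close>

lemma char_hull_preserves_psd_kernel:
  fixes B :: "nat \<Rightarrow> nat \<Rightarrow> complex" and x :: "nat \<Rightarrow> real"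
  assumes "\<phi> \<in> char_hull" and "\<And>c. (\<Sum>i<n. \<Sum>j<n. c i * cnj (c j) * B i j) \<in> \<real>\<^sub>\<ge>\<^sub>0"
  shows "(\<Sum>i<n. \<Sum>j<n. c i * cnj (c j) * (\<phi> (x i - x j) * B i j)) \<in> \<real>\<^sub>\<ge>\<^sub>0"
  using assms
proof (induction arbitrary: B c rule: char_hull.induct)
  case (char s)
  \<comment> \<open>A character splits into a factor in \<open>i\<close> and a conjugate factor in
    \<open>j\<close>, both absorbed into the coefficients.\<close>
  have "cis (s * (x i - x j)) = cis (s * x i) * cnj (cis (s * x j))" for i j
    by (simp add: cis_cnj cis_mult right_diff_distrib)
  then have "(\<Sum>i<n. \<Sum>j<n. c i * cnj (c j) * (cis (s * (x i - x j)) * B i j)) =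
      (\<Sum>i<n. \<Sum>j<n. (c i * cis (s * x i)) * cnj (c j * cis (s * x j)) * B i j)"
    by (simp add: mult_ac)
  then show ?case using char[of "\<lambda>i. c i * cis (s * x i)"] by simp
next
  case (mult f g)
  show ?case
    using mult.IH(1)[OF mult.IH(2)[OF mult.prems]] by (simp add: mult.assoc)
next
  case (comb f g p q)
  have "(\<Sum>i<n. \<Sum>j<n. c i * cnj (c j) * ((of_real p * f (x i - x j) + of_real q * g (x i - x j)) * B i j)) =
      of_real p * (\<Sum>i<n. \<Sum>j<n. c i * cnj (c j) * (f (x i - x j) * B i j)) +
      of_real q * (\<Sum>i<n. \<Sum>j<n. c i * cnj (c j) * (g (x i - x j) * B i j))"
    by (simp add: sum_distrib_left ring_distribs sum.distrib mult_ac)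
  then show ?case
    using comb by (auto intro!: nonneg_Reals_add_I nonneg_Reals_mult_I)
next
  case (lim F f)
  show ?case
  proof (rule closed_sequentially[OF closed_nonneg_Reals_complex])
    show "(\<Sum>i<n. \<Sum>j<n. c i * cnj (c j) * (F k (x i - x j) * B i j)) \<in> \<real>\<^sub>\<ge>\<^sub>0" for k
      using lim.IH[OF lim.prems] .
    show "(\<lambda>k. \<Sum>i<n. \<Sum>j<n. c i * cnj (c j) * (F k (x i - x j) * B i j)) \<longlonglongrightarrow>
        (\<Sum>i<n. \<Sum>j<n. c i * cnj (c j) * (f (x i - x j) * B i j))"
      by (intro tendsto_intros lim.hyps)
  qed
qed

lemma char_hull_positive_definite:
  assumes "\<phi> \<in> char_hull"
  shows "positive_definite_fun \<phi>"
  unfolding positive_definite_fun_def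
proof (intro allI impI)
  fix n :: nat and x :: "nat \<Rightarrow> real" and c :: "nat \<Rightarrow> complex"
  have "(\<Sum>i<n. \<Sum>j<n. c i * cnj (c j) * 1) \<in> \<real>\<^sub>\<ge>\<^sub>0" for c :: "nat \<Rightarrow> complex"
  proof -
    have "(\<Sum>i<n. \<Sum>j<n. c i * cnj (c j) * 1) = (\<Sum>i<n. c i) * cnj (\<Sum>i<n. c i)"
      by (simp add: sum_product)
    also have "\<dots> \<in> \<real>\<^sub>\<ge>\<^sub>0" unfolding complex_norm_square[symmetric] by simp
    finally show ?thesis .
  qed
  from char_hull_preserves_psd_kernel[where B = "\<lambda>i j. 1", OF assms this]
  show "(\<Sum>i<n. \<Sum>j<n. c i * cnj (c j) * \<phi> (x i - x j)) \<in> \<real>\<^sub>\<ge>\<^sub>0" by simp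
qed

section \<open>Unitarily invariant norms\<close>

lemma unitarily_invariant_normD:
  assumes "unitarily_invariant_norm \<nu>"
  shows "0 \<le> \<nu> X" "\<nu> 0 = 0" "\<nu> (\<chi> i j. c * X $ i $ j) = cmod c * \<nu> X" "\<nu> (X + Y) \<le> \<nu> X + \<nu> Y"
    "unitary_matrix U \<Longrightarrow> \<nu> (U ** X) = \<nu> X" "unitary_matrix U \<Longrightarrow> \<nu> (X ** U) = \<nu> X"
  using assms unfolding unitarily_invariant_norm_def by blast+

lemma unitarily_invariant_norm_sum_le:
  assumes \<nu>: "unitarily_invariant_norm \<nu>" and "finite S"
  shows "\<nu> (\<Sum>s\<in>S. X s) \<le> (\<Sum>s\<in>S. \<nu> (X s))"
  using assms(2)
proof (induction S rule: finite_induct)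
  case empty
  show ?case by (simp add: unitarily_invariant_normD(2)[OF \<nu>])
next
  case (insert s S)
  have "\<nu> (X s + (\<Sum>s\<in>S. X s)) \<le> \<nu> (X s) + \<nu> (\<Sum>s\<in>S. X s)"
    by (rule unitarily_invariant_normD(4)[OF \<nu>])
  with insert show ?case by simp
qed

text \<open>Expansion in the matrix units \<open>axis i (axis j 1)\<close>. The bound shows that
  entrywise convergence implies convergence in \<open>\<nu>\<close>, for the limit rule of the
  hull.\<close>

lemma unitarily_invariant_norm_entry_bound:
  fixes \<nu> :: "complex^'n^'n \<Rightarrow> real"
  assumes \<nu>: "unitarily_invariant_norm \<nu>"
  shows "\<nu> Y \<le> (\<Sum>i\<in>UNIV. \<Sum>j\<in>UNIV. cmod (Y $ i $ j) * \<nu> (axis i (axis j 1)))"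
proof -
  have entry: "(\<chi> i' j'. c * (axis i (axis j 1) :: complex^'n^'n) $ i' $ j') = axis i (axis j c)" for i j and c :: complex
    by (simp add: axis_def vec_eq_iff)
  have scale: "\<nu> (axis i (axis j c)) = cmod c * \<nu> (axis i (axis j 1))" for i j c
    using unitarily_invariant_normD(3)[OF \<nu>, of c "axis i (axis j 1)"] unfolding entry .
  have "(\<Sum>i\<in>UNIV. \<Sum>j\<in>UNIV. axis i (axis j (Y $ i $ j)) $ k $ l) = Y $ k $ l" for k l
  proof -
    have "(\<Sum>i\<in>UNIV. \<Sum>j\<in>UNIV. axis i (axis j (Y $ i $ j)) $ k $ l) =
        (\<Sum>i\<in>UNIV. if i = k then (\<Sum>j\<in>UNIV. if j = l then Y $ i $ j else 0) else 0)"
      by (intro sum.cong refl) (auto simp: axis_def intro!: sum.cong)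
    then show ?thesis by simp
  qed
  then have "Y = (\<Sum>i\<in>UNIV. \<Sum>j\<in>UNIV. axis i (axis j (Y $ i $ j)))"
    by (simp add: vec_eq_iff)
  then have "\<nu> Y = \<nu> (\<Sum>i\<in>UNIV. \<Sum>j\<in>UNIV. axis i (axis j (Y $ i $ j)))" by (rule arg_cong)
  also have "\<dots> \<le> (\<Sum>i\<in>UNIV. \<Sum>j\<in>UNIV. \<nu> (axis i (axis j (Y $ i $ j))))"
    by (intro order_trans[OF unitarily_invariant_norm_sum_le[OF \<nu>]] sum_mono
        unitarily_invariant_norm_sum_le[OF \<nu>]) auto
  also have "\<dots> = (\<Sum>i\<in>UNIV. \<Sum>j\<in>UNIV. cmod (Y $ i $ j) * \<nu> (axis i (axis j 1)))"
    by (intro sum.cong refl scale)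
  finally show ?thesis .
qed

text \<open>Characters act by unitaries on both sides and preserve \<open>\<nu>\<close>; products
  iterate contractions, combinations use the triangle inequality with \<open>p + q \<le> 1\<close>,
  and limits use the entry bound.\<close>

lemma char_hull_schur_mult_contraction:
  fixes \<nu> :: "complex^'n^'n \<Rightarrow> real" and x y :: "'n \<Rightarrow> real"
  assumes \<nu>: "unitarily_invariant_norm \<nu>" and "\<phi> \<in> char_hull"
  shows "\<nu> (schur_mult (\<lambda>i j. \<phi> (x i - y j)) Y) \<le> \<nu> Y"
  using assms(2)
proof (induction arbitrary: Y rule: char_hull.induct)
  case (char s)
  let ?D = "\<lambda>d :: 'n \<Rightarrow> real. diag_matrix (\<lambda>i. cis (d i))"
  have "schur_mult (\<lambda>i j. cis (s * (x i - y j))) Y = ?D (\<lambda>i. s * x i) ** (Y ** ?D (\<lambda>j. - s * y j))"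
    by (simp add: vec_eq_iff schur_mult_def diag_matrix_mult_left diag_matrix_mult_right
        right_diff_distrib mult_ac cis_mult[symmetric] flip: cis_divide)
       (simp add: cis_conv_exp exp_minus divide_inverse mult_ac)
  then show ?case
    by (simp only: unitarily_invariant_normD(5,6)[OF \<nu>] unitary_diag_cis)
next
  case (mult f g)
  show ?case
    using mult.IH(1)[of "schur_mult (\<lambda>i j. g (x i - y j)) Y"] mult.IH(2)[of Y]
    by (simp add: schur_mult_schur_mult)
next
  case (comb f g p q)
  let ?S = "\<lambda>f. schur_mult (\<lambda>i j. f (x i - y j)) Y"
  have "?S (\<lambda>x. of_real p * f x + of_real q * g x) =
      (\<chi> i j. of_real p * ?S f $ i $ j) + (\<chi> i j. of_real q * ?S g $ i $ j)"
    by (simp add: vec_eq_iff schur_mult_def algebra_simps)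
  then have "\<nu> (?S (\<lambda>x. of_real p * f x + of_real q * g x)) \<le> p * \<nu> (?S f) + q * \<nu> (?S g)"
    using unitarily_invariant_normD(4)[OF \<nu>, of "\<chi> i j. of_real p * ?S f $ i $ j" "\<chi> i j. of_real q * ?S g $ i $ j"] comb
    unfolding unitarily_invariant_normD(3)[OF \<nu>] by simp
  also have "\<dots> \<le> p * \<nu> Y + q * \<nu> Y"
    using comb by (intro add_mono mult_left_mono) auto
  also have "\<dots> \<le> \<nu> Y"
    using comb mult_right_mono[of "p + q" 1 "\<nu> Y"] unitarily_invariant_normD(1)[OF \<nu>, of Y] by (simp add: distrib_right)
  finally show ?case .
next
  case (lim F f)
  let ?S = "\<lambda>f. schur_mult (\<lambda>i j. f (x i - y j)) Y"
  let ?e = "\<lambda>n. \<Sum>i\<in>UNIV. \<Sum>j\<in>UNIV. cmod ((f (x i - y j) - F n (x i - y j)) * Y $ i $ j) * \<nu> (axis i (axis j 1))"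
  have "\<nu> (?S f) \<le> \<nu> Y + ?e n" for n
  proof -
    have "?S f = ?S (F n) + ?S (\<lambda>x. f x - F n x)"
      by (simp add: vec_eq_iff schur_mult_def algebra_simps)
    then have "\<nu> (?S f) \<le> \<nu> (?S (F n)) + \<nu> (?S (\<lambda>x. f x - F n x))"
      using unitarily_invariant_normD(4)[OF \<nu>] by simp
    also have "\<dots> \<le> \<nu> Y + ?e n"
      using unitarily_invariant_norm_entry_bound[OF \<nu>, of "?S (\<lambda>x. f x - F n x)"] lim.IH
      by (intro add_mono) (simp_all add: schur_mult_def)
    finally show ?thesis .
  qed
  moreover have "(\<lambda>n. \<nu> Y + ?e n) \<longlonglongrightarrow>
      \<nu> Y + (\<Sum>i\<in>UNIV. \<Sum>j\<in>UNIV. cmod ((f (x i - y j) - f (x i - y j)) * Y $ i $ j) * \<nu> (axis i (axis j 1)))"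
    by (intro tendsto_intros lim.hyps)
  ultimately have "\<nu> (?S f) \<le>
      \<nu> Y + (\<Sum>i\<in>UNIV. \<Sum>j\<in>UNIV. cmod ((f (x i - y j) - f (x i - y j)) * Y $ i $ j) * \<nu> (axis i (axis j 1)))"
    by (intro LIMSEQ_le_const) auto
  then show ?case by simp
qed

section \<open>The order relation and the norm inequality\<close>

theorem theorem1p1:
  fixes n m :: nat and \<alpha> \<beta> \<alpha>' \<beta>' :: "real list"
  assumes "n \<ge> 1" and "m \<ge> 1"
    and "length \<alpha> = n" and "length \<beta> = n"
    and "length \<alpha>' = m" and "length \<beta>' = m"
    and "weakly_submajorises (map abs (\<beta> @ \<alpha>')) (map abs (\<alpha> @ \<beta>'))"
  shows "f_fun \<alpha> \<beta> \<preceq> f_fun \<alpha>' \<beta>' \<and>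
    (\<forall>(H :: complex^'N^'N) K X \<nu>.
       positive_matrix H \<and> invertible H \<and> positive_matrix K \<and> invertible K \<and>
       unitarily_invariant_norm \<nu> \<longrightarrow>
       \<nu> (M_op \<alpha> \<beta> H K X) \<le> \<nu> (M_op \<alpha>' \<beta>' H K X))"
proof (intro conjI allI impI)
  define \<phi> :: "real \<Rightarrow> complex" where "\<phi> = (\<lambda>x. of_real (f_fun \<alpha> \<beta> (exp x) / f_fun \<alpha>' \<beta>' (exp x)))"
  have len: "length \<alpha> = length \<beta>" "length \<alpha>' = length \<beta>'" using assms by simp_all
  have \<phi>: "\<phi> \<in> char_hull"
    unfolding \<phi>_def using len assms(7) by (rule f_fun_ratio_char_hull)
  then show "f_fun \<alpha> \<beta> \<preceq> f_fun \<alpha>' \<beta>'"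
    unfolding fun_preceq_def \<phi>_def[symmetric] by (rule char_hull_positive_definite)
  fix H K X :: "complex^'N^'N" and \<nu> :: "complex^'N^'N \<Rightarrow> real"
  assume "positive_matrix H \<and> invertible H \<and> positive_matrix K \<and> invertible K \<and> unitarily_invariant_norm \<nu>"
  then have "positive_matrix H" "invertible H" "positive_matrix K" "invertible K"
    and \<nu>: "unitarily_invariant_norm \<nu>" by auto
  from \<open>positive_matrix H\<close> \<open>invertible H\<close> obtain U h where U: "unitary_matrix U"
      and h: "\<And>i. 0 < h i" and H: "H = U ** diag_matrix (\<lambda>i. of_real (h i)) ** cadjoint U"
    by (rule positive_invertible_diagonalization) blast
  from \<open>positive_matrix K\<close> \<open>invertible K\<close> obtain V k where V: "unitary_matrix V"
      and k: "\<And>j. 0 < k j" and K: "K = V ** diag_matrix (\<lambda>j. of_real (k j)) ** cadjoint V"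
    by (rule positive_invertible_diagonalization) blast
  define Y where "Y = cadjoint U ** X ** V"
  have X: "X = U ** Y ** cadjoint V"
  proof -
    have "U ** Y ** cadjoint V = (U ** cadjoint U) ** X ** (V ** cadjoint V)"
      by (simp add: Y_def matrix_mul_assoc)
    then show ?thesis using U V by (simp add: unitary_matrix_def)
  qed
  let ?g = "\<lambda>i j. complex_of_real (k j * f_fun \<alpha>' \<beta>' (h i / k j))"
  \<comment> \<open>The two multipliers differ by the factor \<open>\<phi>\<close> at a difference
    of logarithms of eigenvalues, so the first operator is a contraction applied after the
    second.\<close>
  have "of_real (k j * f_fun \<alpha> \<beta> (h i / k j)) = \<phi> (ln (h i) - ln (k j)) * ?g i j" for i j
  proof -
    have e: "exp (ln (h i) - ln (k j)) = h i / k j" using h k by (simp add: exp_diff)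
    have "0 < f_fun \<alpha>' \<beta>' (h i / k j)" using f_fun_exp_pos[OF len(2)] by (simp flip: e)
    then show ?thesis unfolding \<phi>_def e by (simp flip: of_real_mult of_real_divide)
  qed
  note ratio = this
  have \<alpha>\<beta>: "schur_mult (\<lambda>i j. of_real (k j * f_fun \<alpha> \<beta> (h i / k j))) Y =
      schur_mult (\<lambda>i j. \<phi> (ln (h i) - ln (k j))) (schur_mult ?g Y)"
    by (simp only: schur_mult_schur_mult ratio)
  have inv: "\<nu> (U ** Z ** cadjoint V) = \<nu> Z" for Z
    by (simp add: unitarily_invariant_normD(5,6)[OF \<nu>] U unitary_cadjoint[OF V])
  show "\<nu> (M_op \<alpha> \<beta> H K X) \<le> \<nu> (M_op \<alpha>' \<beta>' H K X)"
    unfolding X M_op_diagonal[OF U V k H K] inv \<alpha>\<beta> by (rule char_hull_schur_mult_contraction[OF \<nu> \<phi>])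
qed

end
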